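(* $\mathrm{SO}_0=\mathrm{SO}_0(m|2n)(\Lambda_N)$ is a connected Lie group.
   Context: Let $m,n,N\in\mathbb N=\{1,2,\dots\}$. $\Lambda_N$ is the real Grassmann algebra generated by anticommuting $f_1,\dots,f_N$ (dimension $2^N$, basis $f_A$, $A\subset\{1,\dots,N\}$); $\Lambda_N^{(ev)}$ and $\Lambda_N^{(odd)}$ are the spans of the $f_A$ with $|A|$ even, resp. odd. $\mathrm{Mat}(m|2n)(\Lambda_N)$ is the finite-dimensional real algebra (with its usual topology) of supermatrices $M=\begin{pmatrix}A&B'\\C'&D\end{pmatrix}$ with $A,D$ ($m\times m$, $2n\times2n$) having entries in $\Lambda_N^{(ev)}$ and $B',C'$ ($m\times2n$, $2n\times m$) having entries in $\Lambda_N^{(odd)}$. $M^{ST}=\begin{pmatrix}A^T&C'^T\\-B'^T&D^T\end{pmatrix}$; for invertible $M$, $\mathrm{sdet}(M)=\det(A-B'D^{-1}C')\det(D)^{-1}$. $\Omega_{2n}$ is block diagonal with $n$ blocks $\begin{pmatrix}0&1\\-1&0\end{pmatrix}$ and $\mathbf Q=\begin{pmatrix}I_m&0\\0&-\frac12\Omega_{2n}\end{pmatrix}$. Then $\mathrm{O}_0=\{M\in\mathrm{Mat}(m|2n)(\Lambda_N):M^{ST}\mathbf QM-\mathbf Q=0\}$ (its elements are invertible) and $\mathrm{SO}_0=\{M\in\mathrm O_0:\mathrm{sdet}(M)=1\}$, under matrix multiplication. *)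

theory Defs
  imports "HOL-Analysis.Analysis" "HOL-Algebra.Group"
begin

section \<open>The real Grassmann algebra\<close>

text \<open>
  The linearly ordered finite type \<open>'k\<close> plays the role of \<open>{1, \<dots>, N}\<close>, so that \<open>N = CARD('k)\<close>.
  An element is the vector of its coefficients with respect to the basis
  \<open>f\<^sub>A = f\<^sub>a\<^sub>1 \<dots> f\<^sub>a\<^sub>r\<close>, where \<open>A = {a\<^sub>1 < \<dots> < a\<^sub>r}\<close>.
  (A copy of the vector type is needed because the library multiplies vectors componentwise.)
\<close>

typedef (overloaded) ('k::finite) grassmann = "UNIV :: (real, 'k set) vec set"
  morphisms f_coeffs Grassmann
  by simp

setup_lifting type_definition_grassmann

lemma grassmann_eq_iff: "x = y \<longleftrightarrow> (\<forall>A. f_coeffs x $ A = f_coeffs y $ A)"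
  by (metis f_coeffs_inject vec_eq_iff)

lemma f_coeffs_Grassmann [simp]: "f_coeffs (Grassmann v) = v"
  by (simp add: Grassmann_inverse)

instantiation grassmann :: (finite) real_vector
begin

lift_definition zero_grassmann :: "'a grassmann" is "0" .
lift_definition plus_grassmann :: "'a grassmann \<Rightarrow> 'a grassmann \<Rightarrow> 'a grassmann" is "(+)" .
lift_definition minus_grassmann :: "'a grassmann \<Rightarrow> 'a grassmann \<Rightarrow> 'a grassmann" is "(-)" .
lift_definition uminus_grassmann :: "'a grassmann \<Rightarrow> 'a grassmann" is "uminus" .
lift_definition scaleR_grassmann :: "real \<Rightarrow> 'a grassmann \<Rightarrow> 'a grassmann" is "scaleR" .

instance
  by (standard; transfer) (simp_all add: algebra_simps)

end

instantiation grassmann :: (finite) euclidean_space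
begin

lift_definition inner_grassmann :: "'a grassmann \<Rightarrow> 'a grassmann \<Rightarrow> real" is "inner" .
lift_definition norm_grassmann :: "'a grassmann \<Rightarrow> real" is "norm" .
lift_definition dist_grassmann :: "'a grassmann \<Rightarrow> 'a grassmann \<Rightarrow> real" is "dist" .
lift_definition sgn_grassmann :: "'a grassmann \<Rightarrow> 'a grassmann" is "sgn" .

definition Basis_grassmann :: "'a grassmann set" where
  "Basis_grassmann = Grassmann ` Basis"

definition uniformity_grassmann :: "('a grassmann \<times> 'a grassmann) filter" where
  "uniformity_grassmann = (INF e\<in>{0 <..}. principal {(x, y). dist x y < e})"

definition open_grassmann :: "'a grassmann set \<Rightarrow> bool" where
  "open_grassmann U \<longleftrightarrow> (\<forall>x\<in>U. eventually (\<lambda>(x', y). x' = x \<longrightarrow> y \<in> U) uniformity)"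

instance
proof
  show "uniformity = (INF e\<in>{0 <..}. principal {(x::'a grassmann, y). dist x y < e})"
    by (rule uniformity_grassmann_def)
  show "open U \<longleftrightarrow> (\<forall>x\<in>U. eventually (\<lambda>(x', y). x' = x \<longrightarrow> y \<in> U) uniformity)"
    for U :: "'a grassmann set"
    by (rule open_grassmann_def)
  fix x y z :: "'a grassmann" and a :: real
  show "sgn x = x /\<^sub>R norm x" by transfer (simp add: sgn_div_norm)
  show "dist x y = norm (x - y)" by transfer (simp add: dist_norm)
  show "inner x y = inner y x" by transfer (simp add: inner_commute)
  show "inner (x + y) z = inner x z + inner y z" by transfer (simp add: inner_add_left)
  show "inner (a *\<^sub>R x) y = a * inner x y" by transfer simp
  show "0 \<le> inner x x" by transfer simp
  show "inner x x = 0 \<longleftrightarrow> x = 0" by transfer simp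
  show "norm x = sqrt (inner x x)" by transfer (simp add: norm_eq_sqrt_inner)
  show "(Basis :: 'a grassmann set) \<noteq> {}" by (simp add: Basis_grassmann_def)
  show "finite (Basis :: 'a grassmann set)" by (simp add: Basis_grassmann_def)
  show "x \<in> Basis \<Longrightarrow> y \<in> Basis \<Longrightarrow> inner x y = (if x = y then 1 else 0)"
    by (auto simp: Basis_grassmann_def inner_grassmann.rep_eq inner_Basis Grassmann_inject)
  show "(\<forall>u\<in>Basis. inner x u = 0) \<longleftrightarrow> x = 0"
    by (simp add: Basis_grassmann_def inner_grassmann.rep_eq euclidean_all_zero_iff
        zero_grassmann.rep_eq flip: f_coeffs_inject)
qed

end

lemma DIM_grassmann: "DIM('k::finite grassmann) = 2 ^ CARD('k)"
proof -
  have "DIM('k grassmann) = DIM((real, 'k set) vec)"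
    unfolding Basis_grassmann_def by (intro card_image) (simp add: inj_on_def Grassmann_inject)
  then show ?thesis
    by (simp add: card_Pow [of "UNIV :: 'k set", simplified])
qed

text \<open>
  \<open>f\<^sub>A f\<^sub>B = f_sign A B f\<^bsub>A \<union> B\<^esub>\<close>: sorting the product of the two increasing words takes one sign
  change for each inversion, and a repeated generator gives zero.
\<close>

definition f_sign :: "'k::{finite,linorder} set \<Rightarrow> 'k set \<Rightarrow> real" where
  "f_sign A B = (if A \<inter> B = {} then (- 1) ^ card {(i, j). i \<in> A \<and> j \<in> B \<and> j < i} else 0)"

lemma f_sign_empty [simp]: "f_sign {} A = 1" "f_sign A {} = 1"
  by (simp_all add: f_sign_def)

lemma f_sign_Un_left:
  assumes "A \<inter> B = {}"
  shows "f_sign (A \<union> B) C = f_sign A C * f_sign B C"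
proof (cases "(A \<union> B) \<inter> C = {}")
  case True
  have "{(i, j). i \<in> A \<union> B \<and> j \<in> C \<and> j < i} =
      {(i, j). i \<in> A \<and> j \<in> C \<and> j < i} \<union> {(i, j). i \<in> B \<and> j \<in> C \<and> j < i}" by auto
  moreover have "{(i, j). i \<in> A \<and> j \<in> C \<and> j < i} \<inter> {(i, j). i \<in> B \<and> j \<in> C \<and> j < i} = {}"
    using assms by auto
  ultimately have "card {(i, j). i \<in> A \<union> B \<and> j \<in> C \<and> j < i} =
      card {(i, j). i \<in> A \<and> j \<in> C \<and> j < i} + card {(i, j). i \<in> B \<and> j \<in> C \<and> j < i}"
    by (simp add: card_Un_disjoint)
  moreover have "A \<inter> C = {}" "B \<inter> C = {}" using True by auto
  ultimately show ?thesis using True by (simp add: f_sign_def power_add)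
qed (auto simp: f_sign_def)

lemma f_sign_Un_right:
  assumes "B \<inter> C = {}"
  shows "f_sign A (B \<union> C) = f_sign A B * f_sign A C"
proof (cases "A \<inter> (B \<union> C) = {}")
  case True
  have "{(i, j). i \<in> A \<and> j \<in> B \<union> C \<and> j < i} =
      {(i, j). i \<in> A \<and> j \<in> B \<and> j < i} \<union> {(i, j). i \<in> A \<and> j \<in> C \<and> j < i}" by auto
  moreover have "{(i, j). i \<in> A \<and> j \<in> B \<and> j < i} \<inter> {(i, j). i \<in> A \<and> j \<in> C \<and> j < i} = {}"
    using assms by auto
  ultimately have "card {(i, j). i \<in> A \<and> j \<in> B \<union> C \<and> j < i} =
      card {(i, j). i \<in> A \<and> j \<in> B \<and> j < i} + card {(i, j). i \<in> A \<and> j \<in> C \<and> j < i}"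
    by (simp add: card_Un_disjoint)
  moreover have "A \<inter> B = {}" "A \<inter> C = {}" using True by auto
  ultimately show ?thesis using True by (simp add: f_sign_def power_add)
qed (auto simp: f_sign_def)

lemma f_sign_assoc: "f_sign A B * f_sign (A \<union> B) C = f_sign A (B \<union> C) * f_sign B C"
proof (cases "A \<inter> B = {} \<and> B \<inter> C = {}")
  case True
  then show ?thesis by (simp add: f_sign_Un_left f_sign_Un_right)
qed (auto simp: f_sign_def)

lemma f_sign_commute: "f_sign B A = (- 1) ^ (card A * card B) * f_sign A B"
proof (cases "A \<inter> B = {}")
  case True
  let ?I = "{(i, j). i \<in> A \<and> j \<in> B \<and> j < i}" and ?J = "{(i, j). i \<in> A \<and> j \<in> B \<and> i < j}"
  let ?J' = "{(i, j). i \<in> B \<and> j \<in> A \<and> j < i}"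
  have "?J' = prod.swap ` ?J" by auto
  then have J: "card ?J' = card ?J" by (simp add: card_image)
  have "A \<times> B = ?I \<union> ?J" using True by (auto simp: disjoint_iff) (metis linorder_neqE)
  moreover have "?I \<inter> ?J = {}" by auto
  ultimately have "card (A \<times> B) = card ?I + card ?J" by (simp add: card_Un_disjoint)
  then have IJ: "card ?I + card ?J' = card A * card B" using J by (simp add: card_cartesian_product)
  then have "(- 1 :: real) ^ (card A * card B) * (- 1) ^ card ?I =
      (- 1) ^ card ?J' * ((- 1) ^ card ?I * (- 1) ^ card ?I)"
    by (simp add: power_add flip: IJ)
  also have "\<dots> = (- 1) ^ card ?J'" by (simp flip: power_mult_distrib)
  finally show ?thesis using True by (simp add: f_sign_def Int_commute)
qed (auto simp: f_sign_def)

instantiation grassmann :: ("{finite,linorder}") real_algebra_1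
begin

definition one_grassmann :: "'a grassmann" where
  "1 = Grassmann (axis {} 1)"

definition times_grassmann :: "'a grassmann \<Rightarrow> 'a grassmann \<Rightarrow> 'a grassmann" where
  "x * y = Grassmann (\<chi> C. \<Sum>A\<in>UNIV. \<Sum>B\<in>UNIV.
     if A \<union> B = C then f_sign A B * (f_coeffs x $ A * f_coeffs y $ B) else 0)"

lemma f_coeffs_times: "f_coeffs (x * y) $ C = (\<Sum>A\<in>UNIV. \<Sum>B\<in>UNIV.
    if A \<union> B = C then f_sign A B * (f_coeffs x $ A * f_coeffs y $ B) else 0)"
  by (simp add: times_grassmann_def)

lemma f_coeffs_one: "f_coeffs (1::'a grassmann) $ A = (if A = {} then 1 else 0)"
  by (simp add: one_grassmann_def axis_def)

instance
proof
  fix x y z :: "'a grassmann" and a :: real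
  show "(x + y) * z = x * z + y * z"
    by (simp add: grassmann_eq_iff f_coeffs_times plus_grassmann.rep_eq flip: sum.distrib)
      (intro allI sum.cong refl, simp add: plus_grassmann.rep_eq algebra_simps)
  show "x * (y + z) = x * y + x * z"
    by (simp add: grassmann_eq_iff f_coeffs_times plus_grassmann.rep_eq flip: sum.distrib)
      (intro allI sum.cong refl, simp add: plus_grassmann.rep_eq algebra_simps)
  show "a *\<^sub>R x * y = a *\<^sub>R (x * y)"
    by (simp add: grassmann_eq_iff f_coeffs_times scaleR_grassmann.rep_eq sum_distrib_left)
      (intro allI sum.cong refl, simp add: scaleR_grassmann.rep_eq)
  show "x * a *\<^sub>R y = a *\<^sub>R (x * y)"
    by (simp add: grassmann_eq_iff f_coeffs_times scaleR_grassmann.rep_eq sum_distrib_left)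
      (intro allI sum.cong refl, simp add: scaleR_grassmann.rep_eq)
  show "(0::'a grassmann) \<noteq> 1"
    by (auto simp: grassmann_eq_iff f_coeffs_one zero_grassmann.rep_eq)
  show "1 * x = x"
  proof (unfold grassmann_eq_iff, rule allI)
    fix C
    have "f_coeffs (1 * x) $ C = (\<Sum>A\<in>UNIV. \<Sum>B\<in>UNIV. if B = C then (if A = ({}::'a set) then f_coeffs x $ B else 0) else 0)"
      unfolding f_coeffs_times by (intro sum.cong refl) (auto simp: f_coeffs_one)
    also have "\<dots> = f_coeffs x $ C" by (simp add: sum.delta)
    finally show "f_coeffs (1 * x) $ C = f_coeffs x $ C" .
  qed
  show "x * 1 = x"
  proof (unfold grassmann_eq_iff, rule allI)
    fix C
    have "f_coeffs (x * 1) $ C = (\<Sum>A\<in>UNIV. \<Sum>B\<in>UNIV. if B = ({}::'a set) then (if A = C then f_coeffs x $ A else 0) else 0)"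
      unfolding f_coeffs_times by (intro sum.cong refl) (auto simp: f_coeffs_one)
    also have "\<dots> = f_coeffs x $ C" by (simp add: sum.delta)
    finally show "f_coeffs (x * 1) $ C = f_coeffs x $ C" .
  qed
  show "x * y * z = x * (y * z)"
  proof (unfold grassmann_eq_iff, rule allI)
    fix E
    let ?x = "\<lambda>A. f_coeffs x $ A" and ?y = "\<lambda>A. f_coeffs y $ A" and ?z = "\<lambda>A. f_coeffs z $ A"
    have "f_coeffs (x * y * z) $ E = (\<Sum>D\<in>UNIV. \<Sum>C\<in>UNIV. \<Sum>A\<in>UNIV. \<Sum>B\<in>UNIV.
        if A \<union> B = D then (if D \<union> C = E then f_sign D C * f_sign A B * (?x A * ?y B * ?z C) else 0) else 0)"
      unfolding f_coeffs_times
    proof (intro sum.cong refl, goal_cases)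
      case (1 D C)
      show ?case
        by (cases "D \<union> C = E")
          (auto simp: sum_distrib_left sum_distrib_right intro!: sum.cong cong: if_cong)
    qed
    also have "\<dots> = (\<Sum>C\<in>UNIV. \<Sum>A\<in>UNIV. \<Sum>B\<in>UNIV. \<Sum>D\<in>UNIV.
        if A \<union> B = D then (if D \<union> C = E then f_sign D C * f_sign A B * (?x A * ?y B * ?z C) else 0) else 0)"
      by (rule trans [OF sum.swap], rule sum.cong [OF refl],
          rule trans [OF sum.swap], rule sum.cong [OF refl], rule sum.swap)
    also have "\<dots> = (\<Sum>C\<in>UNIV. \<Sum>A\<in>UNIV. \<Sum>B\<in>UNIV.
        if A \<union> B \<union> C = E then f_sign A B * f_sign (A \<union> B) C * (?x A * ?y B * ?z C) else 0)"
      by (simp add: sum.delta' mult_ac cong: if_cong)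
    also have "\<dots> = (\<Sum>A\<in>UNIV. \<Sum>B\<in>UNIV. \<Sum>C\<in>UNIV.
        if A \<union> B \<union> C = E then f_sign A B * f_sign (A \<union> B) C * (?x A * ?y B * ?z C) else 0)"
      by (rule trans [OF sum.swap], rule sum.cong [OF refl], rule sum.swap)
    finally have L: "f_coeffs (x * y * z) $ E = \<dots>" .
    have "f_coeffs (x * (y * z)) $ E = (\<Sum>A\<in>UNIV. \<Sum>D\<in>UNIV. \<Sum>B\<in>UNIV. \<Sum>C\<in>UNIV.
        if B \<union> C = D then (if A \<union> D = E then f_sign A D * f_sign B C * (?x A * ?y B * ?z C) else 0) else 0)"
      unfolding f_coeffs_times
    proof (intro sum.cong refl, goal_cases)
      case (1 A D)
      show ?case
        by (cases "A \<union> D = E")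
          (auto simp: sum_distrib_left sum_distrib_right intro!: sum.cong cong: if_cong)
    qed
    also have "\<dots> = (\<Sum>A\<in>UNIV. \<Sum>B\<in>UNIV. \<Sum>C\<in>UNIV. \<Sum>D\<in>UNIV.
        if B \<union> C = D then (if A \<union> D = E then f_sign A D * f_sign B C * (?x A * ?y B * ?z C) else 0) else 0)"
      by (rule sum.cong [OF refl], rule trans [OF sum.swap], rule sum.cong [OF refl], rule sum.swap)
    also have "\<dots> = (\<Sum>A\<in>UNIV. \<Sum>B\<in>UNIV. \<Sum>C\<in>UNIV.
        if A \<union> (B \<union> C) = E then f_sign A (B \<union> C) * f_sign B C * (?x A * ?y B * ?z C) else 0)"
      by (simp add: sum.delta' cong: if_cong)
    finally show "f_coeffs (x * y * z) $ E = f_coeffs (x * (y * z)) $ E"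
      unfolding L by (simp only: f_sign_assoc Un_assoc)
  qed
qed

end

definition f_basis :: "'k::finite set \<Rightarrow> 'k grassmann" where
  "f_basis A = Grassmann (axis A 1)"

abbreviation f_gen :: "'k::finite \<Rightarrow> 'k grassmann" where
  "f_gen i \<equiv> f_basis {i}"

lemma f_basis_times: "f_basis A * f_basis B = f_sign A B *\<^sub>R f_basis (A \<union> B)"
proof (unfold grassmann_eq_iff, rule allI)
  fix C
  have "f_coeffs (f_basis A * f_basis B) $ C = (\<Sum>A'\<in>UNIV. \<Sum>B'\<in>UNIV.
      if B' = B then (if A' = A then (if A' \<union> B' = C then f_sign A' B' else 0) else 0) else 0)"
    unfolding f_coeffs_times f_basis_def f_coeffs_Grassmann
    by (intro sum.cong refl) (auto simp: axis_def)
  also have "\<dots> = f_coeffs (f_sign A B *\<^sub>R f_basis (A \<union> B)) $ C"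
    by (auto simp: sum.delta scaleR_grassmann.rep_eq f_basis_def axis_def)
  finally show "f_coeffs (f_basis A * f_basis B) $ C = f_coeffs (f_sign A B *\<^sub>R f_basis (A \<union> B)) $ C" .
qed

lemma f_gen_anticommute: "f_gen i * f_gen j = - (f_gen j * f_gen i)"
  unfolding f_basis_times by (subst f_sign_commute) (simp add: insert_commute)

lemma f_basis_eq_prod:
  fixes A :: "'k::{finite,linorder} set"
  shows "f_basis A = prod_list (map f_gen (sorted_list_of_set A))"
proof -
  have "f_basis (set xs) = prod_list (map f_gen xs)" if "sorted_wrt (<) xs" for xs :: "'k list"
    using that
  proof (induction xs)
    case Nil
    show ?case by (simp add: f_basis_def one_grassmann_def)
  next
    case (Cons a xs)
    have "{(i, j). i \<in> {a} \<and> j \<in> set xs \<and> j < i} = {}" "{a} \<inter> set xs = {}"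
      using Cons.prems by (auto simp: not_less_iff_gr_or_eq)
    then have "f_sign {a} (set xs) = 1"
      unfolding f_sign_def by (simp only: card.empty power_0 simp_thms if_True)
    then show ?case using Cons by (simp flip: Cons.IH add: f_basis_times)
  qed
  from this [of "sorted_list_of_set A"] show ?thesis by simp
qed

definition gr_even :: "'k::finite grassmann set" where
  "gr_even = span {f_basis A | A. even (card A)}"

definition gr_odd :: "'k::finite grassmann set" where
  "gr_odd = span {f_basis A | A. odd (card A)}"

lemma grassmann_expansion: "x = (\<Sum>A\<in>UNIV. (f_coeffs x $ A) *\<^sub>R f_basis A)"
proof (unfold grassmann_eq_iff, rule allI)
  fix C
  have s: "f_coeffs (sum g S) $ C = (\<Sum>A\<in>S. f_coeffs (g A) $ C)" for g :: "'a set \<Rightarrow> 'a grassmann" and S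
    by (induction S rule: infinite_finite_induct)
      (simp_all add: zero_grassmann.rep_eq plus_grassmann.rep_eq)
  show "f_coeffs x $ C = f_coeffs (\<Sum>A\<in>UNIV. (f_coeffs x $ A) *\<^sub>R f_basis A) $ C"
    unfolding s by (simp add: scaleR_grassmann.rep_eq f_basis_def axis_def if_distrib sum.delta cong: if_cong)
qed

lemma span_f_basis_iff:
  "x \<in> span {f_basis A | A. P A} \<longleftrightarrow> (\<forall>A. \<not> P A \<longrightarrow> f_coeffs x $ A = 0)"
proof
  assume "x \<in> span {f_basis A | A. P A}"
  then show "\<forall>A. \<not> P A \<longrightarrow> f_coeffs x $ A = 0"
  proof (induction rule: span_induct)
    case base
    show ?case
      by (auto simp: subspace_def zero_grassmann.rep_eq plus_grassmann.rep_eq scaleR_grassmann.rep_eq)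
  next
    case (step y)
    then show ?case by (auto simp: f_basis_def axis_def)
  qed
next
  assume *: "\<forall>A. \<not> P A \<longrightarrow> f_coeffs x $ A = 0"
  have "(\<Sum>A\<in>UNIV. (f_coeffs x $ A) *\<^sub>R f_basis A) \<in> span {f_basis A | A. P A}"
  proof (rule span_sum)
    fix A :: "'a set"
    show "(f_coeffs x $ A) *\<^sub>R f_basis A \<in> span {f_basis A | A. P A}"
      by (cases "P A") (use * in \<open>auto intro: span_base span_scale span_zero\<close>)
  qed
  then show "x \<in> span {f_basis A | A. P A}" by (simp flip: grassmann_expansion)
qed

lemma gr_even_iff: "x \<in> gr_even \<longleftrightarrow> (\<forall>A. odd (card A) \<longrightarrow> f_coeffs x $ A = 0)"
  by (simp add: gr_even_def span_f_basis_iff)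

lemma gr_odd_iff: "x \<in> gr_odd \<longleftrightarrow> (\<forall>A. even (card A) \<longrightarrow> f_coeffs x $ A = 0)"
  by (simp add: gr_odd_def span_f_basis_iff)

lemma gr_even_times:
  assumes "x \<in> gr_even" "y \<in> gr_even"
  shows "x * y \<in> gr_even"
  unfolding gr_even_iff f_coeffs_times
proof (intro allI impI sum.neutral ballI)
  fix C A B :: "'a set"
  assume "odd (card C)"
  then show "(if A \<union> B = C then f_sign A B * (f_coeffs x $ A * f_coeffs y $ B) else 0) = 0"
    using assms by (cases "A \<inter> B = {}") (auto simp: gr_even_iff f_sign_def card_Un_disjoint)
qed

lemma gr_even_commute:
  assumes "x \<in> gr_even"
  shows "x * y = y * x"
proof (unfold grassmann_eq_iff, rule allI)
  fix C
  have "f_coeffs (x * y) $ C = (\<Sum>A\<in>UNIV. \<Sum>B\<in>UNIV.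
      if B \<union> A = C then f_sign B A * (f_coeffs y $ B * f_coeffs x $ A) else 0)"
    unfolding f_coeffs_times
  proof (intro sum.cong refl)
    fix A B :: "'a set"
    show "(if A \<union> B = C then f_sign A B * (f_coeffs x $ A * f_coeffs y $ B) else 0) =
        (if B \<union> A = C then f_sign B A * (f_coeffs y $ B * f_coeffs x $ A) else 0)"
    proof (cases "even (card A)")
      case True
      then show ?thesis by (subst f_sign_commute [of B A]) (auto simp: Un_commute)
    next
      case False
      then show ?thesis using assms by (simp add: gr_even_iff)
    qed
  qed
  also have "\<dots> = f_coeffs (y * x) $ C" unfolding f_coeffs_times by (rule sum.swap)
  finally show "f_coeffs (x * y) $ C = f_coeffs (y * x) $ C" .
qed

text \<open>
  The even part as a commutative ring of its own, so that determinants of matrices with even entries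
  are the library's determinants.
\<close>

typedef (overloaded) ('k::"{finite,linorder}") even_grassmann = "gr_even :: 'k grassmann set"
  morphisms of_even Even
  by (auto simp: gr_even_def intro: span_zero)

setup_lifting type_definition_even_grassmann

instantiation even_grassmann :: ("{finite,linorder}") comm_ring_1
begin

lift_definition zero_even_grassmann :: "'a even_grassmann" is "0"
  by (simp add: gr_even_def span_zero)
lift_definition one_even_grassmann :: "'a even_grassmann" is "1"
  by (auto simp: gr_even_iff f_coeffs_one)
lift_definition plus_even_grassmann :: "'a even_grassmann \<Rightarrow> 'a even_grassmann \<Rightarrow> 'a even_grassmann" is "(+)"
  by (simp add: gr_even_def span_add)
lift_definition minus_even_grassmann :: "'a even_grassmann \<Rightarrow> 'a even_grassmann \<Rightarrow> 'a even_grassmann" is "(-)"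
  by (simp add: gr_even_def span_diff)
lift_definition uminus_even_grassmann :: "'a even_grassmann \<Rightarrow> 'a even_grassmann" is "uminus"
  by (simp add: gr_even_def span_neg)
lift_definition times_even_grassmann :: "'a even_grassmann \<Rightarrow> 'a even_grassmann \<Rightarrow> 'a even_grassmann" is "(*)"
  by (rule gr_even_times)

instance
proof
  fix x y z :: "'a even_grassmann"
  show "x + y + z = x + (y + z)" by transfer (simp add: add.assoc)
  show "x + y = y + x" by transfer (simp add: add.commute)
  show "0 + x = x" by transfer simp
  show "- x + x = 0" by transfer simp
  show "x - y = x + - y" by transfer simp
  show "x * y * z = x * (y * z)" by transfer (simp add: mult.assoc)
  show "x * y = y * x" by transfer (simp add: gr_even_commute)
  show "1 * x = x" by transfer simp
  show "(x + y) * z = x * z + y * z" by transfer (simp add: distrib_right)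
  show "(0::'a even_grassmann) \<noteq> 1" by transfer simp
qed

end

text \<open>Only meaningful for matrices all of whose entries are in \<open>gr_even\<close>.\<close>

definition even_det :: "'k::{finite,linorder} grassmann ^ 'i ^ 'i \<Rightarrow> 'k grassmann" where
  "even_det A = of_even (det (\<chi> i j. Even (A $ i $ j)))"

text \<open>Only meaningful for invertible elements.\<close>

definition gr_inverse :: "'k::{finite,linorder} grassmann \<Rightarrow> 'k grassmann" where
  "gr_inverse x = (THE y. x * y = 1 \<and> y * x = 1)"


section \<open>Supermatrices\<close>

text \<open>
  \<open>m = CARD('m)\<close> and \<open>n = CARD('n)\<close>. The index \<open>Inr (i, False)\<close>, resp. \<open>Inr (i, True)\<close>, is the first,
  resp. second, index of the \<open>i\<close>-th of the \<open>n\<close> two-by-two blocks.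
\<close>

type_synonym ('m, 'n, 'k) supermatrix =
  "(('k grassmann, 'm + 'n \<times> bool) vec, 'm + 'n \<times> bool) vec"

definition blockA :: "('m::finite, 'n::finite, 'k::finite) supermatrix \<Rightarrow> 'k grassmann ^ 'm ^ 'm" where
  "blockA M = (\<chi> i j. M $ Inl i $ Inl j)"

definition blockB :: "('m::finite, 'n::finite, 'k::finite) supermatrix \<Rightarrow> 'k grassmann ^ ('n \<times> bool) ^ 'm" where
  "blockB M = (\<chi> i j. M $ Inl i $ Inr j)"

definition blockC :: "('m::finite, 'n::finite, 'k::finite) supermatrix \<Rightarrow> 'k grassmann ^ 'm ^ ('n \<times> bool)" where
  "blockC M = (\<chi> i j. M $ Inr i $ Inl j)"

definition blockD :: "('m::finite, 'n::finite, 'k::finite) supermatrix \<Rightarrow> 'k grassmann ^ ('n \<times> bool) ^ ('n \<times> bool)" where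
  "blockD M = (\<chi> i j. M $ Inr i $ Inr j)"

definition block_matrix ::
  "'k grassmann ^ 'm ^ 'm \<Rightarrow> 'k grassmann ^ ('n \<times> bool) ^ 'm \<Rightarrow>
   'k grassmann ^ 'm ^ ('n \<times> bool) \<Rightarrow> 'k grassmann ^ ('n \<times> bool) ^ ('n \<times> bool) \<Rightarrow>
   ('m::finite, 'n::finite, 'k::finite) supermatrix" where
  "block_matrix A B C D = (\<chi> r s. case r of
     Inl i \<Rightarrow> (case s of Inl j \<Rightarrow> A $ i $ j | Inr j \<Rightarrow> B $ i $ j)
   | Inr i \<Rightarrow> (case s of Inl j \<Rightarrow> C $ i $ j | Inr j \<Rightarrow> D $ i $ j))"

definition Mat :: "('m::finite, 'n::finite, 'k::finite) supermatrix set" where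
  "Mat = {M. (\<forall>i j. blockA M $ i $ j \<in> gr_even) \<and> (\<forall>i j. blockB M $ i $ j \<in> gr_odd) \<and>
             (\<forall>i j. blockC M $ i $ j \<in> gr_odd) \<and> (\<forall>i j. blockD M $ i $ j \<in> gr_even)}"

definition supertranspose ::
  "('m::finite, 'n::finite, 'k::finite) supermatrix \<Rightarrow> ('m, 'n, 'k) supermatrix" where
  "supertranspose M = block_matrix
     (transpose (blockA M)) (transpose (blockC M))
     (- transpose (blockB M)) (transpose (blockD M))"

definition sdet :: "('m::finite, 'n::finite, 'k::{finite,linorder}) supermatrix \<Rightarrow> 'k grassmann" where
  "sdet M = even_det (blockA M - blockB M ** matrix_inv (blockD M) ** blockC M)
            * gr_inverse (even_det (blockD M))"

definition Omega :: "'k::{finite,linorder} grassmann ^ ('n::finite \<times> bool) ^ ('n \<times> bool)" where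
  "Omega = (\<chi> r s. if fst r = fst s
     then (if \<not> snd r \<and> snd s then 1 else if snd r \<and> \<not> snd s then - 1 else 0) else 0)"

definition Q_form :: "('m::finite, 'n::finite, 'k::{finite,linorder}) supermatrix" where
  "Q_form = block_matrix (mat 1) 0 0 ((- 1/2) *\<^sub>R Omega)"

definition O\<^sub>0 :: "('m::finite, 'n::finite, 'k::{finite,linorder}) supermatrix set" where
  "O\<^sub>0 = {M \<in> Mat. supertranspose M ** Q_form ** M - Q_form = 0}"

definition SO\<^sub>0 :: "('m::finite, 'n::finite, 'k::{finite,linorder}) supermatrix set" where
  "SO\<^sub>0 = {M \<in> O\<^sub>0. sdet M = 1}"

definition SO\<^sub>0_group :: "('m::finite, 'n::finite, 'k::{finite,linorder}) supermatrix monoid" where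
  "SO\<^sub>0_group = \<lparr>carrier = SO\<^sub>0, mult = (**), one = mat 1\<rparr>"


section \<open>Lie groups\<close>

text \<open>
  Manifolds are modelled on a linear subspace \<open>V\<close> of a Euclidean space, so that their dimension,
  \<open>dim V\<close>, need not be the dimension of a type. In the following definition \<open>U\<close> is meant to be open
  in \<open>V\<close>; the derivative \<open>f' x\<close> is then determined on \<open>V\<close> (and only there), and \<open>\<lambda>x. f' x v\<close> is the
  directional derivative of \<open>f\<close> along \<open>v\<close>.
\<close>

primrec Ck_on :: "nat \<Rightarrow> 'e::euclidean_space set \<Rightarrow> 'e set \<Rightarrow> ('e \<Rightarrow> 'f::euclidean_space) \<Rightarrow> bool" where
  "Ck_on 0 V U f \<longleftrightarrow> continuous_on U f"
| "Ck_on (Suc k) V U f \<longleftrightarrow>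
     (\<exists>f'. (\<forall>x\<in>U. (f has_derivative f' x) (at x within U)) \<and>
           (\<forall>v\<in>V. Ck_on k V U (\<lambda>x. f' x v)))"

definition smooth_on :: "'e::euclidean_space set \<Rightarrow> 'e set \<Rightarrow> ('e \<Rightarrow> 'f::euclidean_space) \<Rightarrow> bool" where
  "smooth_on V U f \<longleftrightarrow> (\<forall>k. Ck_on k V U f)"

type_synonym ('a, 'e) chart = "'a set \<times> ('a \<Rightarrow> 'e)"

definition is_chart :: "'e::euclidean_space set \<Rightarrow> 'a topology \<Rightarrow> ('a, 'e) chart \<Rightarrow> bool" where
  "is_chart V X = (\<lambda>(U, \<phi>). openin X U \<and> openin (top_of_set V) (\<phi> ` U) \<and>
     homeomorphic_map (subtopology X U) (top_of_set (\<phi> ` U)) \<phi>)"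

definition smooth_manifold ::
  "'e::euclidean_space set \<Rightarrow> 'a topology \<Rightarrow> ('a, 'e) chart set \<Rightarrow> bool" where
  "smooth_manifold V X \<A> \<longleftrightarrow>
     subspace V \<and> Hausdorff_space X \<and> second_countable X \<and>
     (\<forall>c\<in>\<A>. is_chart V X c) \<and>
     (\<Union>(U, \<phi>)\<in>\<A>. U) = topspace X \<and>
     (\<forall>(U, \<phi>)\<in>\<A>. \<forall>(U', \<phi>')\<in>\<A>. smooth_on V (\<phi> ` (U \<inter> U')) (\<phi>' \<circ> inv_into U \<phi>))"

definition smooth_map ::
  "'e::euclidean_space set \<Rightarrow> 'a topology \<Rightarrow> ('a, 'e) chart set \<Rightarrow>
   'b topology \<Rightarrow> ('b, 'f::euclidean_space) chart set \<Rightarrow> ('a \<Rightarrow> 'b) \<Rightarrow> bool" where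
  "smooth_map V X \<A> Y \<B> f \<longleftrightarrow>
     continuous_map X Y f \<and>
     (\<forall>(U, \<phi>)\<in>\<A>. \<forall>(W, \<psi>)\<in>\<B>. smooth_on V (\<phi> ` {x \<in> U. f x \<in> W}) (\<psi> \<circ> f \<circ> inv_into U \<phi>))"

definition prod_atlas ::
  "('a, 'e) chart set \<Rightarrow> ('b, 'f) chart set \<Rightarrow> ('a \<times> 'b, 'e \<times> 'f) chart set" where
  "prod_atlas \<A> \<B> = (\<lambda>((U, \<phi>), (W, \<psi>)). (U \<times> W, map_prod \<phi> \<psi>)) ` (\<A> \<times> \<B>)"

definition lie_group ::
  "'e::euclidean_space set \<Rightarrow> ('a, 'e) chart set \<Rightarrow> 'a topology \<Rightarrow> 'a monoid \<Rightarrow> bool" where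
  "lie_group V \<A> X G \<longleftrightarrow>
     group G \<and> topspace X = carrier G \<and> smooth_manifold V X \<A> \<and>
     smooth_map (V \<times> V) (prod_topology X X) (prod_atlas \<A> \<A>) X \<A> (\<lambda>(x, y). x \<otimes>\<^bsub>G\<^esub> y) \<and>
     smooth_map V X \<A> X \<A> (m_inv G)"

end

theory Submission
  imports Defs
begin

text \<open>
  Put \<open>star M = Q\<^sup>-\<^sup>1 M\<^sup>S\<^sup>T Q\<close>. This linear map reverses products of supermatrices in \<open>Mat\<close>, and \<open>O\<^sub>0\<close> consists of the \<open>M\<close>
  in \<open>Mat\<close> with \<open>star M M = 1\<close>. As for every group of this kind, the Cayley transform
  \<open>X \<mapsto> (1 - X) (1 + X)\<^sup>-\<^sup>1\<close> is its own inverse and exchanges group elements \<open>M\<close> for which \<open>1 + M\<close> is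
  invertible with elements \<open>X\<close> of the linear space \<open>star X = - X\<close> for which \<open>1 + X\<close> is. Its translates are an atlas, and all
  coordinate expressions are built from products, inverses and linear maps, so they are smooth
  (locale \<open>cayley_group\<close>, theorem \<open>lie_group_G\<close>).

  For \<open>SO\<^sub>0\<close> this argument needs that the condition \<open>sdet M = 1\<close> is open in \<open>O\<^sub>0\<close> and compatible with
  products. Both are clear from \<open>sdet_eq_1_iff\<close>: for \<open>M\<close> in \<open>O\<^sub>0\<close> the condition says that the body of the upper
  left block, a real orthogonal matrix, has determinant \<open>1\<close>. To see this, one computes that
  \<open>sdet M\<close> is the inverse of \<open>det A det D\<close>, whose square is \<open>det (1 - P R) det (1 - R P)\<close> for certain odd matrices
  \<open>P\<close> and \<open>R\<close>. Odd entries anticommute, which makes this product \<open>1\<close> (\<open>even_det_odd_swap\<close>). So \<open>sdet M\<close> is a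
  square root of \<open>1\<close> in a ring in which everything with body zero is nilpotent, and is determined by its body.

  For connectedness, let \<open>M\<^sub>0\<close> be the body of \<open>M\<close>, an element of \<open>SO(m) \<times> Sp(2n)\<close>. The quotient \<open>M M\<^sub>0\<^sup>-\<^sup>1\<close> has
  body \<open>1\<close>, so its Cayley transform \<open>X\<close> has body \<open>0\<close>, every \<open>1 + t X\<close> is invertible, and the Cayley transforms of
  \<open>t X\<close> are a path to the identity (\<open>path_component_unipotent\<close>). The real groups are connected
  because \<open>SO(m)\<close> is generated by products of two reflections and \<open>Sp(2n)\<close> by transvections, which can both be deformed
  to the identity (\<open>path_component_special_orthogonal\<close>, \<open>path_component_symplectic\<close>).
\<close>


section \<open>Calculus of smooth maps on subsets of a Euclidean space\<close>

lemma Ck_on_cong: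
  assumes "Ck_on k V U f" and "\<And>x. x \<in> U \<Longrightarrow> f x = g x"
  shows "Ck_on k V U g"
proof (cases k)
  case 0
  then show ?thesis using assms by (simp cong: continuous_on_cong)
next
  case (Suc l)
  then obtain f' where "\<And>x. x \<in> U \<Longrightarrow> (f has_derivative f' x) (at x within U)"
    and f': "\<And>v. v \<in> V \<Longrightarrow> Ck_on l V U (\<lambda>x. f' x v)"
    using assms(1) by auto
  then have "\<And>x. x \<in> U \<Longrightarrow> (g has_derivative f' x) (at x within U)"
    by (metis assms(2) has_derivative_transform)
  with f' show ?thesis unfolding Suc Ck_on.simps by blast
qed

lemma Ck_on_SucD: "Ck_on (Suc k) V U f \<Longrightarrow> Ck_on k V U f"
proof (induction k arbitrary: f)
  case 0
  then show ?case
    by (auto simp: continuous_on_eq_continuous_within intro: has_derivative_continuous)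
next
  case (Suc k)
  then obtain f' where "\<forall>x\<in>U. (f has_derivative f' x) (at x within U)"
    and "\<forall>v\<in>V. Ck_on (Suc k) V U (\<lambda>x. f' x v)"
    unfolding Ck_on.simps(2) [of "Suc k"] by blast
  with Suc.IH show ?case unfolding Ck_on.simps(2) [of k] by blast
qed

lemma Ck_on_const: "Ck_on k V U (\<lambda>x. c)"
proof (induction k arbitrary: c)
  case (Suc k)
  then show ?case
    unfolding Ck_on.simps by (intro exI [of _ "\<lambda>x v. 0"]) auto
qed simp

lemma Ck_on_bounded_linear:
  assumes "bounded_linear h"
  shows "Ck_on k V U h"
proof (cases k)
  case 0
  then show ?thesis by (simp add: assms linear_continuous_on)
next
  case (Suc l)
  then show ?thesis
    unfolding Suc Ck_on.simps
    by (intro exI [of _ "\<lambda>x. h"]) (simp add: assms bounded_linear_imp_has_derivative Ck_on_const)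
qed

lemma Ck_on_add:
  assumes "Ck_on k V U f" "Ck_on k V U g"
  shows "Ck_on k V U (\<lambda>x. f x + g x)"
  using assms
proof (induction k arbitrary: f g)
  case (Suc k)
  from Suc.prems(1) obtain f' where
      f': "\<And>x. x \<in> U \<Longrightarrow> (f has_derivative f' x) (at x within U)"
        "\<And>v. v \<in> V \<Longrightarrow> Ck_on k V U (\<lambda>x. f' x v)"
    by auto
  from Suc.prems(2) obtain g' where
      g': "\<And>x. x \<in> U \<Longrightarrow> (g has_derivative g' x) (at x within U)"
        "\<And>v. v \<in> V \<Longrightarrow> Ck_on k V U (\<lambda>x. g' x v)"
    by auto
  show ?case
    unfolding Ck_on.simps
    by (intro exI [of _ "\<lambda>x v. f' x v + g' x v"] conjI ballI has_derivative_add f' g' Suc.IH)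
qed (simp add: continuous_on_add)

text \<open>The directional derivatives of a product are sums of products of the same kind, so
  the functions of class \<open>C\<^sup>k\<close> are closed under products by induction on \<open>k\<close>.\<close>

lemma Ck_on_bilinear:
  assumes b: "bounded_bilinear b" and "Ck_on k V U f" "Ck_on k V U g"
  shows "Ck_on k V U (\<lambda>x. b (f x) (g x))"
  using assms(2,3)
proof (induction k arbitrary: f g)
  case 0
  then show ?case using bounded_bilinear.continuous_on [OF b] by simp
next
  case (Suc k)
  from Suc.prems(1) obtain f' where
      f': "\<And>x. x \<in> U \<Longrightarrow> (f has_derivative f' x) (at x within U)"
        "\<And>v. v \<in> V \<Longrightarrow> Ck_on k V U (\<lambda>x. f' x v)"
    by auto
  from Suc.prems(2) obtain g' where
      g': "\<And>x. x \<in> U \<Longrightarrow> (g has_derivative g' x) (at x within U)"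
        "\<And>v. v \<in> V \<Longrightarrow> Ck_on k V U (\<lambda>x. g' x v)"
    by auto
  show ?case
    unfolding Ck_on.simps
    by (intro exI [of _ "\<lambda>x v. b (f x) (g' x v) + b (f' x v) (g x)"] conjI ballI
        bounded_bilinear.FDERIV [OF b] Ck_on_add f' g' Suc.IH
        Ck_on_SucD [OF Suc.prems(1)] Ck_on_SucD [OF Suc.prems(2)])
qed

lemma Ck_on_linear_comp:
  assumes "bounded_linear h" "Ck_on k V U f"
  shows "Ck_on k V U (\<lambda>x. h (f x))"
proof -
  \<comment> \<open>A linear map is a product with the constant function \<open>1\<close>.\<close>
  have "bounded_bilinear (\<lambda>(r::real) y. r *\<^sub>R h y)"
    by (rule bounded_bilinear.comp [OF bounded_bilinear_scaleR bounded_linear_ident assms(1)])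
  from Ck_on_bilinear [OF this Ck_on_const [of k V U "1::real"] assms(2)] show ?thesis by simp
qed

lemma smooth_on_cong:
  assumes "smooth_on V U f" and "\<And>x. x \<in> U \<Longrightarrow> f x = g x"
  shows "smooth_on V U g"
  using assms unfolding smooth_on_def by (blast intro: Ck_on_cong)

lemma smooth_on_const: "smooth_on V U (\<lambda>x. c)"
  by (simp add: smooth_on_def Ck_on_const)

lemma smooth_on_bounded_linear: "bounded_linear h \<Longrightarrow> smooth_on V U h"
  by (simp add: smooth_on_def Ck_on_bounded_linear)

lemma smooth_on_linear_comp: "bounded_linear h \<Longrightarrow> smooth_on V U f \<Longrightarrow> smooth_on V U (\<lambda>x. h (f x))"
  by (simp add: smooth_on_def Ck_on_linear_comp)

lemma smooth_on_add:
  "smooth_on V U f \<Longrightarrow> smooth_on V U g \<Longrightarrow> smooth_on V U (\<lambda>x. f x + g x)"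
  by (simp add: smooth_on_def Ck_on_add)

lemma smooth_on_diff:
  assumes "smooth_on V U f" "smooth_on V U g"
  shows "smooth_on V U (\<lambda>x. f x - g x)"
  using smooth_on_add [OF assms(1) smooth_on_linear_comp [OF bounded_linear_minus [OF bounded_linear_ident] assms(2)]]
  by simp

lemma smooth_on_bilinear:
  "bounded_bilinear b \<Longrightarrow> smooth_on V U f \<Longrightarrow> smooth_on V U g \<Longrightarrow> smooth_on V U (\<lambda>x. b (f x) (g x))"
  by (simp add: smooth_on_def Ck_on_bilinear)


section \<open>Finite-dimensional algebras and their units\<close>

text \<open>The multiplication is a parameter rather than that of a type class, since
  the multiplication of matrices is not the one of their vector type.\<close>

locale fin_dim_algebra =
  fixes mul :: "'e::euclidean_space \<Rightarrow> 'e \<Rightarrow> 'e" (infixl "\<odot>" 70) and e :: 'e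
  assumes mul_bilinear: "bounded_bilinear (\<odot>)"
    and mul_assoc: "(x \<odot> y) \<odot> z = x \<odot> (y \<odot> z)"
    and left_unit [simp]: "e \<odot> x = x"
    and right_unit [simp]: "x \<odot> e = x"
begin

lemmas mul_algebra =
  bounded_bilinear.add_left [OF mul_bilinear] bounded_bilinear.add_right [OF mul_bilinear]
  bounded_bilinear.diff_left [OF mul_bilinear] bounded_bilinear.diff_right [OF mul_bilinear]
  bounded_bilinear.minus_left [OF mul_bilinear] bounded_bilinear.minus_right [OF mul_bilinear]
  bounded_bilinear.scaleR_left [OF mul_bilinear] bounded_bilinear.scaleR_right [OF mul_bilinear]
  bounded_bilinear.zero_left [OF mul_bilinear] bounded_bilinear.zero_right [OF mul_bilinear]

definition unit :: "'e \<Rightarrow> bool" where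
  "unit x \<longleftrightarrow> (\<exists>y. x \<odot> y = e \<and> y \<odot> x = e)"

definition inverse_of :: "'e \<Rightarrow> 'e" where
  "inverse_of x = (SOME y. x \<odot> y = e \<and> y \<odot> x = e)"

lemma linear_mul_left: "linear ((\<odot>) x)"
  using bounded_bilinear.bounded_linear_right [OF mul_bilinear] bounded_linear.linear by blast

text \<open>An injective endomorphism of a finite-dimensional space is surjective. Hence one-sided
  inverses are inverses.\<close>

lemma unitI_injective:
  assumes "\<And>z. x \<odot> z = 0 \<Longrightarrow> z = 0"
  shows "unit x"
proof -
  have "inj ((\<odot>) x)"
    using linear_injective_0 [OF linear_mul_left] assms by blast
  then have "surj ((\<odot>) x)"
    using linear_mul_left linear_injective_imp_surjective by blast
  then obtain y where y: "x \<odot> y = e" by (metis surjD)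
  have "x \<odot> (y \<odot> x - e) = 0" by (simp add: mul_algebra y flip: mul_assoc)
  then have "y \<odot> x - e = 0" by (rule assms)
  then have "y \<odot> x = e" by simp
  with y show ?thesis unfolding unit_def by blast
qed

lemma unitI_left:
  assumes "y \<odot> x = e"
  shows "unit x" "x \<odot> y = e"
proof -
  show u: "unit x"
  proof (rule unitI_injective)
    fix z assume "x \<odot> z = 0"
    then have "(y \<odot> x) \<odot> z = 0" by (simp add: mul_assoc mul_algebra)
    then show "z = 0" by (simp add: assms)
  qed
  then obtain y' where "x \<odot> y' = e" by (auto simp: unit_def)
  then have "y \<odot> x \<odot> y' = y" by (simp add: mul_assoc)
  then have "y' = y" by (simp add: assms)
  then show "x \<odot> y = e" using \<open>x \<odot> y' = e\<close> by simp
qed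

lemma unitI_right:
  assumes "x \<odot> y = e"
  shows "unit x" "y \<odot> x = e"
proof -
  show "y \<odot> x = e" by (rule unitI_left(2) [OF assms])
  then show "unit x" using assms by (auto simp: unit_def)
qed

lemma inverse_of: "unit x \<Longrightarrow> x \<odot> inverse_of x = e" "unit x \<Longrightarrow> inverse_of x \<odot> x = e"
  using someI_ex [of "\<lambda>y. x \<odot> y = e \<and> y \<odot> x = e"] by (auto simp: inverse_of_def unit_def)

lemma inverse_of_cancel:
  assumes "unit x"
  shows "x \<odot> (inverse_of x \<odot> y) = y" "inverse_of x \<odot> (x \<odot> y) = y"
  by (simp_all add: inverse_of assms flip: mul_assoc)

lemma inverse_of_unique:
  assumes "x \<odot> y = e"
  shows "inverse_of x = y"
  using inverse_of_cancel(2) [OF unitI_right(1) [OF assms], of y] by (simp add: assms)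

lemma unit_scaleR:
  assumes "unit x" "r \<noteq> 0"
  shows "unit (r *\<^sub>R x)"
  by (rule unitI_right [of _ "(1 / r) *\<^sub>R inverse_of x"]) (simp add: mul_algebra inverse_of assms)

lemma unit_e [simp]: "unit e"
  by (rule unitI_right [of _ e]) simp

text \<open>Multiplication by \<open>x\<close> is an injective, hence surjective, endomorphism of \<open>B\<close>.\<close>

lemma inverse_of_in_subalgebra:
  assumes B: "subspace B" "e \<in> B" "\<And>y. y \<in> B \<Longrightarrow> x \<odot> y \<in> B" and x: "unit x"
  shows "inverse_of x \<in> B"
proof -
  have "inj_on ((\<odot>) x) B" by (metis inj_onI inverse_of_cancel(2) x)
  then have "dim ((\<odot>) x ` B) = dim B"
    by (intro dim_image_eq linear_mul_left) (simp add: span_eq_iff [THEN iffD2, OF B(1)])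
  moreover have "(\<odot>) x ` B \<subseteq> B" using B(3) by blast
  moreover have "subspace ((\<odot>) x ` B)" by (rule linear_subspace_image [OF linear_mul_left B(1)])
  ultimately have "(\<odot>) x ` B = B" by (simp add: subspace_dim_equal B(1))
  then obtain y where "y \<in> B" "x \<odot> y = e" using B(2) by (metis imageE)
  then show ?thesis using inverse_of_unique by metis
qed

text \<open>For \<open>x\<close> close to \<open>a\<close> the operator \<open>z \<mapsto> inverse_of a \<odot> ((x - a) \<odot> z)\<close> at least halves norms. Therefore
  \<open>x \<odot> z = 0\<close> forces \<open>z = 0\<close>, and the difference \<open>y\<close> of the two inverses, which this operator maps to
  \<open>- y\<close> up to a term of the order of \<open>x - a\<close>, is of that order itself.\<close>

lemma inverse_estimate:
  assumes a: "unit a"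
  obtains C d where "d > 0" "C \<ge> 0"
    "\<And>x. norm (x - a) < d \<Longrightarrow> unit x"
    "\<And>x. norm (x - a) < d \<Longrightarrow> norm (inverse_of x - inverse_of a) \<le> C * norm (x - a)"
proof -
  obtain K where K: "K > 0" "\<And>x y. norm (x \<odot> y) \<le> norm x * norm y * K"
    using bounded_bilinear.pos_bounded [OF mul_bilinear] by blast
  define M where "M = norm (inverse_of a) * K"
  have M0: "M \<ge> 0" using K by (simp add: M_def)
  define d where "d = 1 / (2 * K * (M + 1))"
  have d: "d > 0" using K M0 by (simp add: d_def)
  have small: "M * (norm (x - a) * K) \<le> 1 / 2" if "norm (x - a) < d" for x
  proof -
    have "norm (x - a) * (2 * K * (M + 1)) \<le> 1"
      using that K M0 unfolding d_def by (simp add: pos_less_divide_eq)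
    then have "2 * K * norm (x - a) * M + 2 * K * norm (x - a) \<le> 1" by (simp add: algebra_simps)
    moreover have "2 * K * norm (x - a) \<ge> 0" using K by simp
    ultimately have "2 * K * norm (x - a) * M \<le> 1" by linarith
    then show ?thesis by (simp add: algebra_simps)
  qed
  have half: "norm (inverse_of a \<odot> ((x - a) \<odot> z)) \<le> norm z / 2" if "norm (x - a) < d" for x z
  proof -
    have "norm (inverse_of a \<odot> ((x - a) \<odot> z)) \<le> norm (inverse_of a) * norm ((x - a) \<odot> z) * K"
      by (rule K)
    also have "\<dots> \<le> norm (inverse_of a) * (norm (x - a) * norm z * K) * K"
      using K by (intro mult_right_mono mult_left_mono) auto
    also have "\<dots> = M * (norm (x - a) * K) * norm z" by (simp add: M_def mult_ac)
    also have "\<dots> \<le> 1 / 2 * norm z" by (intro mult_right_mono small that) simp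
    finally show ?thesis by simp
  qed
  have unit: "unit x" if "norm (x - a) < d" for x
  proof (rule unitI_injective)
    fix z assume "x \<odot> z = 0"
    then have "inverse_of a \<odot> ((x - a) \<odot> z) = - z"
      by (simp add: mul_algebra inverse_of_cancel a)
    with half [OF that, of z] show "z = 0" by simp
  qed
  have diff: "norm (inverse_of x - inverse_of a) \<le> 2 * M * M * norm (x - a)" if "norm (x - a) < d" for x
  proof -
    define y where "y = inverse_of x - inverse_of a"
    have "inverse_of a \<odot> ((x - a) \<odot> y) = - y - inverse_of a \<odot> ((x - a) \<odot> inverse_of a)"
      by (simp add: y_def mul_algebra inverse_of_cancel inverse_of a unit [OF that] mul_assoc)
    moreover have "norm p \<le> norm q + norm r" if "q = - p - r" for p q r :: 'e
      using norm_triangle_ineq [of q r] that by simp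
    ultimately have "norm y \<le> norm (inverse_of a \<odot> ((x - a) \<odot> y))
        + norm (inverse_of a \<odot> ((x - a) \<odot> inverse_of a))"
      by blast
    then have "norm y \<le> 2 * norm (inverse_of a \<odot> ((x - a) \<odot> inverse_of a))"
      using half [OF that, of y] by linarith
    also have "norm (inverse_of a \<odot> ((x - a) \<odot> inverse_of a))
        \<le> norm (inverse_of a) * norm ((x - a) \<odot> inverse_of a) * K"
      by (rule K)
    also have "\<dots> \<le> norm (inverse_of a) * (norm (x - a) * norm (inverse_of a) * K) * K"
      using K by (intro mult_right_mono mult_left_mono) auto
    finally show ?thesis by (simp add: y_def M_def mult_ac)
  qed
  show ?thesis
    by (rule that [of d "2 * M * M"]) (use d M0 unit diff in auto)
qed

lemma open_units: "open (Collect unit)"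
  unfolding open_dist
proof clarify
  fix a assume "unit a"
  then obtain C d where "d > 0" "C \<ge> 0" "\<And>x. norm (x - a) < d \<Longrightarrow> unit x"
    "\<And>x. norm (x - a) < d \<Longrightarrow> norm (inverse_of x - inverse_of a) \<le> C * norm (x - a)"
    by (rule inverse_estimate) blast
  then show "\<exists>d>0. \<forall>x. dist x a < d \<longrightarrow> x \<in> Collect unit" by (auto simp: dist_norm)
qed

lemma inverse_of_has_derivative:
  assumes a: "unit a"
  shows "(inverse_of has_derivative (\<lambda>v. - (inverse_of a \<odot> v \<odot> inverse_of a))) (at a within S)"
proof -
  obtain C d where Cd: "d > 0" "C \<ge> 0"
    "\<And>x. norm (x - a) < d \<Longrightarrow> unit x"
    "\<And>x. norm (x - a) < d \<Longrightarrow> norm (inverse_of x - inverse_of a) \<le> C * norm (x - a)"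
    by (rule inverse_estimate [OF a]) blast
  obtain K where K: "K > 0" "\<And>x y. norm (x \<odot> y) \<le> norm x * norm y * K"
    using bounded_bilinear.pos_bounded [OF mul_bilinear] by blast
  let ?C = "C * K * norm (inverse_of a) * K"
  have lin: "bounded_linear (\<lambda>v. - (inverse_of a \<odot> v \<odot> inverse_of a))"
    by (intro bounded_linear_minus bounded_linear_compose [OF bounded_bilinear.bounded_linear_left [OF mul_bilinear]]
        bounded_bilinear.bounded_linear_right [OF mul_bilinear])
  have "norm (inverse_of x - inverse_of a - - (inverse_of a \<odot> (x - a) \<odot> inverse_of a)) / norm (x - a)
      \<le> ?C * norm (x - a)" if "x \<noteq> a" "norm (x - a) < d" for x
  proof -
    \<comment> \<open>The error is a product of two small factors.\<close>
    have "inverse_of x - inverse_of a - - (inverse_of a \<odot> (x - a) \<odot> inverse_of a)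
        = - ((inverse_of x - inverse_of a) \<odot> (x - a) \<odot> inverse_of a)"
      by (simp add: mul_algebra mul_assoc inverse_of inverse_of_cancel a Cd(3) [OF that(2)])
    then have "norm (inverse_of x - inverse_of a - - (inverse_of a \<odot> (x - a) \<odot> inverse_of a))
        = norm ((inverse_of x - inverse_of a) \<odot> (x - a) \<odot> inverse_of a)"
      by (simp only: norm_minus_cancel)
    also have "\<dots> \<le> norm ((inverse_of x - inverse_of a) \<odot> (x - a)) * norm (inverse_of a) * K" by (rule K)
    also have "\<dots> \<le> (norm (inverse_of x - inverse_of a) * norm (x - a) * K) * norm (inverse_of a) * K"
      using K by (intro mult_right_mono) auto
    also have "\<dots> \<le> (C * norm (x - a) * norm (x - a) * K) * norm (inverse_of a) * K"
      using K Cd(4) [OF that(2)] by (intro mult_right_mono) auto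
    finally show ?thesis using that(1) by (simp add: divide_simps mult_ac)
  qed
  moreover have "((\<lambda>x. ?C * norm (x - a)) \<longlongrightarrow> 0) (at a within S)"
    by (intro tendsto_eq_intros) auto
  ultimately show ?thesis
    using lin Cd(1) unfolding dist_norm [symmetric]
    by (intro has_derivativeI_sandwich [of d _ _ _ _ "\<lambda>x. ?C * dist x a"]) (auto simp: dist_norm)
qed

lemma continuous_on_inverse_of:
  assumes "continuous_on U f" "\<And>x. x \<in> U \<Longrightarrow> unit (f x)"
  shows "continuous_on U (\<lambda>x. inverse_of (f x))"
proof -
  have "continuous_on (Collect unit) inverse_of"
    by (auto simp: continuous_on_eq_continuous_within
        intro: has_derivative_continuous [OF inverse_of_has_derivative])
  then show ?thesis by (rule continuous_on_compose2) (use assms in auto)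
qed

lemma continuous_on_mul:
  "continuous_on U f \<Longrightarrow> continuous_on U g \<Longrightarrow> continuous_on U (\<lambda>x. f x \<odot> g x)"
  by (rule bounded_bilinear.continuous_on [OF mul_bilinear])

lemma smooth_on_mul:
  "smooth_on V U f \<Longrightarrow> smooth_on V U g \<Longrightarrow> smooth_on V U (\<lambda>x. f x \<odot> g x)"
  by (rule smooth_on_bilinear [OF mul_bilinear])

text \<open>The derivative of the inverse is again expressed by the inverse, which carries the induction
  on the order of differentiability.\<close>

lemma smooth_on_inverse_of:
  assumes "smooth_on V U f" and unit: "\<And>x. x \<in> U \<Longrightarrow> unit (f x)"
  shows "smooth_on V U (\<lambda>x. inverse_of (f x))"
  unfolding smooth_on_def
proof
  fix k
  have "Ck_on k V U f" using assms by (simp add: smooth_on_def)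
  then show "Ck_on k V U (\<lambda>x. inverse_of (f x))"
  proof (induction k)
    case 0
    then show ?case using unit by (simp add: continuous_on_inverse_of)
  next
    case (Suc k)
    then obtain f' where f': "\<And>x. x \<in> U \<Longrightarrow> (f has_derivative f' x) (at x within U)"
        "\<And>v. v \<in> V \<Longrightarrow> Ck_on k V U (\<lambda>x. f' x v)"
      by auto
    have IH: "Ck_on k V U (\<lambda>x. inverse_of (f x))" by (rule Suc.IH [OF Ck_on_SucD [OF Suc.prems]])
    have "((\<lambda>x. inverse_of (f x)) has_derivative
        (\<lambda>v. - (inverse_of (f x) \<odot> f' x v \<odot> inverse_of (f x)))) (at x within U)" if "x \<in> U" for x
      using has_derivative_compose [OF f'(1) [OF that] inverse_of_has_derivative [OF unit [OF that]]] .
    moreover have "Ck_on k V U (\<lambda>x. - (inverse_of (f x) \<odot> f' x v \<odot> inverse_of (f x)))" if "v \<in> V" for v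
      by (intro Ck_on_linear_comp [OF bounded_linear_minus [OF bounded_linear_ident]]
          Ck_on_bilinear [OF mul_bilinear] IH f' that)
    ultimately show ?case
      unfolding Ck_on.simps
      by (intro exI [of _ "\<lambda>x v. - (inverse_of (f x) \<odot> f' x v \<odot> inverse_of (f x))"]) blast
  qed
qed

definition cayley :: "'e \<Rightarrow> 'e" where
  "cayley x = (e - x) \<odot> inverse_of (e + x)"

lemma continuous_on_cayley:
  "continuous_on U f \<Longrightarrow> (\<And>x. x \<in> U \<Longrightarrow> unit (e + f x)) \<Longrightarrow> continuous_on U (\<lambda>x. cayley (f x))"
  unfolding cayley_def
  by (intro continuous_on_mul continuous_on_inverse_of continuous_intros)

lemma smooth_on_cayley:
  "smooth_on V U f \<Longrightarrow> (\<And>x. x \<in> U \<Longrightarrow> unit (e + f x)) \<Longrightarrow> smooth_on V U (\<lambda>x. cayley (f x))"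
  unfolding cayley_def
  by (intro smooth_on_mul smooth_on_inverse_of smooth_on_add smooth_on_diff smooth_on_const)

lemma e_plus_cayley:
  assumes "unit (e + x)"
  shows "e + cayley x = 2 *\<^sub>R inverse_of (e + x)"
proof -
  have "e + cayley x = ((e + x) + (e - x)) \<odot> inverse_of (e + x)"
    unfolding cayley_def mul_algebra(1) [of "e + x"] using inverse_of(1) [OF assms] by simp
  also have "(e + x) + (e - x) = 2 *\<^sub>R e" by (simp add: scaleR_2)
  finally show ?thesis by (simp add: mul_algebra)
qed

lemma unit_e_plus_cayley: "unit (e + x) \<Longrightarrow> unit (e + cayley x)"
  using unitI_right(1) [OF inverse_of(2), of "e + x"] by (simp add: e_plus_cayley unit_scaleR)

lemma cayley_cayley:
  assumes "unit (e + x)"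
  shows "cayley (cayley x) = x"
proof -
  have "inverse_of (e + cayley x) = (1/2) *\<^sub>R (e + x)"
    by (rule inverse_of_unique) (simp add: e_plus_cayley assms mul_algebra(7,8) inverse_of(2))
  moreover have "e - cayley x = 2 *\<^sub>R e - (e + cayley x)" by (simp add: scaleR_2)
  then have "e - cayley x = 2 *\<^sub>R (e - inverse_of (e + x))"
    by (simp only: e_plus_cayley assms scaleR_right_diff_distrib)
  ultimately have "cayley (cayley x) = (e - inverse_of (e + x)) \<odot> (e + x)"
    unfolding cayley_def [of "cayley x"] by (simp only: mul_algebra(7,8)) simp
  also have "\<dots> = x" unfolding mul_algebra(3) by (simp add: inverse_of(2) assms)
  finally show ?thesis .
qed

lemma cayley_0 [simp]: "cayley 0 = e"
  by (simp add: cayley_def inverse_of_unique)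

lemma cayley_in_subalgebra:
  assumes B: "subspace B" "e \<in> B" "\<And>x y. x \<in> B \<Longrightarrow> y \<in> B \<Longrightarrow> x \<odot> y \<in> B"
    and x: "x \<in> B" "unit (e + x)"
  shows "cayley x \<in> B"
proof -
  have "e + x \<in> B" "e - x \<in> B" using B x by (auto intro: subspace_add subspace_diff)
  then show ?thesis
    unfolding cayley_def using B inverse_of_in_subalgebra [OF B(1,2) _ x(2)] by blast
qed

end

section \<open>The Lie group structure given by the Cayley transform\<close>

text \<open>
  Inside a subalgebra \<open>B\<close> with a linear map \<open>star\<close> that reverses products, \<open>G\<close> is a group of elements whose
  inverse is their image under \<open>star\<close>, as in an orthogonal or a unitary group.
  It need not be the group of all these elements. The last assumption takes care that it is open
  in that group, at least where the Cayley transform is defined.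
\<close>

locale cayley_group = fin_dim_algebra mul e
  for mul :: "'e::euclidean_space \<Rightarrow> 'e \<Rightarrow> 'e" (infixl "\<odot>" 70) and e :: 'e +
  fixes B :: "'e set" and star :: "'e \<Rightarrow> 'e" and G :: "'e set"
  assumes subspace_B: "subspace B"
    and e_in_B: "e \<in> B"
    and mul_in_B: "x \<in> B \<Longrightarrow> y \<in> B \<Longrightarrow> x \<odot> y \<in> B"
    and linear_star: "linear star"
    and star_mul: "x \<in> B \<Longrightarrow> y \<in> B \<Longrightarrow> star (x \<odot> y) = star y \<odot> star x"
    and star_e: "star e = e"
    and G_subset_B: "G \<subseteq> B"
    and star_G: "x \<in> G \<Longrightarrow> star x \<odot> x = e"
    and e_in_G: "e \<in> G"
    and mul_in_G: "x \<in> G \<Longrightarrow> y \<in> G \<Longrightarrow> x \<odot> y \<in> G"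
    and star_in_G: "x \<in> G \<Longrightarrow> star x \<in> G"
    and cayley_in_G: "x \<in> B \<Longrightarrow> star x = - x \<Longrightarrow> unit (e + x) \<Longrightarrow>
      star (cayley x) \<odot> cayley x = e \<Longrightarrow> cayley x \<in> G"
begin

definition skew :: "'e set" where
  "skew = {x \<in> B. star x = - x}"

definition the_group :: "'e monoid" where
  "the_group = \<lparr>carrier = G, mult = (\<odot>), one = e\<rparr>"

lemma star_bounded_linear: "bounded_linear star"
  by (rule linear_conv_bounded_linear [THEN iffD1, OF linear_star])

lemmas star_linear_simps =
  linear_add [OF linear_star] linear_diff [OF linear_star] linear_neg [OF linear_star]
  linear_scale [OF linear_star] linear_0 [OF linear_star]

lemma subspace_skew: "subspace skew"
  using subspace_B unfolding skew_def subspace_def by (auto simp: star_linear_simps)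

lemma star_G': "x \<in> G \<Longrightarrow> x \<odot> star x = e"
  by (rule unitI_left(2) [OF star_G])

lemma inverse_of_in_B: "x \<in> B \<Longrightarrow> unit x \<Longrightarrow> inverse_of x \<in> B"
  by (rule inverse_of_in_subalgebra [OF subspace_B e_in_B]) (auto intro: mul_in_B)

lemma star_inverse_of:
  assumes "x \<in> B" "unit x"
  shows "unit (star x)" "star (inverse_of x) = inverse_of (star x)"
proof -
  have "star (inverse_of x) \<odot> star x = e"
    using star_mul [OF assms(1) inverse_of_in_B [OF assms]] by (simp add: inverse_of assms star_e)
  then show "unit (star x)" "star (inverse_of x) = inverse_of (star x)"
    using unitI_left inverse_of_unique [symmetric] by blast+
qed

lemma skewD: "x \<in> skew \<Longrightarrow> x \<in> B" "x \<in> skew \<Longrightarrow> star x = - x"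
  by (simp_all add: skew_def)

lemma cayley_in_B: "x \<in> B \<Longrightarrow> unit (e + x) \<Longrightarrow> cayley x \<in> B"
  by (rule cayley_in_subalgebra [OF subspace_B e_in_B]) (auto intro: mul_in_B)

text \<open>For skew \<open>x\<close> the factors \<open>e - x\<close> and \<open>inverse_of (e + x)\<close> of the Cayley transform are carried by \<open>star\<close> to
  \<open>e + x\<close> and \<open>inverse_of (e - x)\<close>, and all these factors commute.\<close>

lemma cayley_skew:
  assumes x: "x \<in> skew" and u: "unit (e + x)"
  shows "cayley x \<in> G"
proof -
  have B: "e + x \<in> B" "e - x \<in> B"
    using skewD(1) [OF x] e_in_B subspace_B by (auto intro: subspace_add subspace_diff)
  have u': "unit (e - x)"
    using star_inverse_of(1) [OF B(1) u] by (simp add: star_linear_simps star_e skewD(2) [OF x])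
  have "star (cayley x) = star (inverse_of (e + x)) \<odot> star (e - x)"
    unfolding cayley_def by (rule star_mul [OF B(2) inverse_of_in_B [OF B(1) u]])
  also have "\<dots> = inverse_of (e - x) \<odot> (e + x)"
    by (simp add: star_inverse_of(2) B u star_linear_simps star_e skewD(2) [OF x])
  finally have "star (cayley x) \<odot> cayley x
      = inverse_of (e - x) \<odot> ((e + x) \<odot> (e - x)) \<odot> inverse_of (e + x)"
    by (simp add: cayley_def mul_assoc)
  also have "(e + x) \<odot> (e - x) = (e - x) \<odot> (e + x)" by (simp add: mul_algebra)
  also have "inverse_of (e - x) \<odot> ((e - x) \<odot> (e + x)) \<odot> inverse_of (e + x) = e"
    by (simp add: inverse_of_cancel inverse_of u u')
  finally show ?thesis
    using cayley_in_G skewD [OF x] u by blast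
qed

lemma cayley_G:
  assumes x: "x \<in> G" and u: "unit (e + x)"
  shows "cayley x \<in> skew"
proof -
  have B: "e + x \<in> B" "e - x \<in> B" "x \<in> B"
    using x G_subset_B e_in_B subspace_B by (auto intro: subspace_add subspace_diff)
  have us: "unit (e + star x)"
    using star_inverse_of(1) [OF B(1) u] by (simp add: star_linear_simps star_e)
  have "star (cayley x) = star (inverse_of (e + x)) \<odot> star (e - x)"
    unfolding cayley_def by (rule star_mul [OF B(2) inverse_of_in_B [OF B(1) u]])
  also have "\<dots> = inverse_of (e + star x) \<odot> (e - star x)"
    by (simp add: star_inverse_of(2) B u star_linear_simps star_e)
  finally have L: "(e + star x) \<odot> star (cayley x) = e - star x"
    by (simp add: inverse_of_cancel us)
  have "(e + star x) \<odot> (e - x) \<odot> inverse_of (e + x) = (star x - e) \<odot> (e + x) \<odot> inverse_of (e + x)"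
    by (simp add: mul_algebra star_G x)
  also have "\<dots> = star x - e" by (simp add: mul_assoc inverse_of u)
  finally have "(e + star x) \<odot> cayley x = star x - e" by (simp add: cayley_def mul_assoc)
  with L have "(e + star x) \<odot> (star (cayley x) + cayley x) = 0" by (simp add: mul_algebra(2))
  then have "star (cayley x) + cayley x = 0"
    using inverse_of_cancel(2) [OF us, of "star (cayley x) + cayley x"] by (simp add: mul_algebra(10))
  then show ?thesis
    using cayley_in_B [OF B(3) u] by (simp add: skew_def eq_neg_iff_add_eq_0)
qed

lemma group_the_group: "group the_group"
  by (rule groupI) (auto simp: the_group_def mul_assoc e_in_G mul_in_G intro: star_in_G star_G)

lemma m_inv_the_group: "x \<in> G \<Longrightarrow> m_inv the_group x = star x"
  by (rule group.inv_equality [OF group_the_group]) (auto simp: the_group_def star_G star_in_G)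

text \<open>The chart at \<open>g\<close> is the Cayley transform translated to \<open>g\<close>. All charts have the same image \<open>W\<close>.\<close>

definition W :: "'e set" where
  "W = {x \<in> skew. unit (e + x)}"

definition U :: "'e \<Rightarrow> 'e set" where
  "U g = {x \<in> G. unit (e + star g \<odot> x)}"

definition \<phi> :: "'e \<Rightarrow> 'e \<Rightarrow> 'e" where
  "\<phi> g x = cayley (star g \<odot> x)"

definition atlas :: "('e, 'e) chart set" where
  "atlas = (\<lambda>g. (U g, \<phi> g)) ` G"

lemma \<phi>_W: "g \<in> G \<Longrightarrow> x \<in> U g \<Longrightarrow> \<phi> g x \<in> W"
  by (auto simp: W_def U_def \<phi>_def intro!: cayley_G unit_e_plus_cayley mul_in_G star_in_G)

lemma chart_inverse_U: "g \<in> G \<Longrightarrow> y \<in> W \<Longrightarrow> g \<odot> cayley y \<in> U g"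
  by (auto simp: W_def U_def star_G unit_e_plus_cayley cayley_skew mul_in_G simp flip: mul_assoc)

lemma chart_inverse_right: "g \<in> G \<Longrightarrow> y \<in> W \<Longrightarrow> \<phi> g (g \<odot> cayley y) = y"
  by (auto simp: W_def \<phi>_def star_G cayley_cayley simp flip: mul_assoc)

lemma chart_inverse_left: "g \<in> G \<Longrightarrow> x \<in> U g \<Longrightarrow> g \<odot> cayley (\<phi> g x) = x"
  by (auto simp: U_def \<phi>_def star_G' cayley_cayley simp flip: mul_assoc)

lemma \<phi>_image: "g \<in> G \<Longrightarrow> \<phi> g ` U g = W"
  by (metis (no_types, lifting) \<phi>_W chart_inverse_U chart_inverse_right image_eqI image_subsetI subsetI subset_antisym)

lemma inj_\<phi>: "g \<in> G \<Longrightarrow> inj_on (\<phi> g) (U g)"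
  by (metis chart_inverse_left inj_onI)

lemma inv_into_\<phi>: "g \<in> G \<Longrightarrow> y \<in> W \<Longrightarrow> inv_into (U g) (\<phi> g) y = g \<odot> cayley y"
  using inv_into_f_eq [OF inj_\<phi>] chart_inverse_U chart_inverse_right by blast

lemma openin_U: "openin (top_of_set G) (U g)"
proof -
  have "open ((\<lambda>x. e + star g \<odot> x) -` Collect unit)"
    by (intro open_vimage open_units continuous_intros continuous_on_mul)
  moreover have "U g = G \<inter> (\<lambda>x. e + star g \<odot> x) -` Collect unit" by (auto simp: U_def)
  ultimately show ?thesis by (auto simp: openin_open)
qed

lemma openin_W: "openin (top_of_set skew) W"
proof -
  have "open ((\<lambda>x. e + x) -` Collect unit)"
    by (intro open_vimage open_units continuous_intros)
  moreover have "W = skew \<inter> (\<lambda>x. e + x) -` Collect unit" by (auto simp: W_def)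
  ultimately show ?thesis by (auto simp: openin_open)
qed

lemma smooth_on_\<phi>:
  assumes "smooth_on V S f" "\<And>x. x \<in> S \<Longrightarrow> f x \<in> U g"
  shows "smooth_on V S (\<lambda>x. \<phi> g (f x))"
  unfolding \<phi>_def
  by (rule smooth_on_cayley [OF smooth_on_mul [OF smooth_on_const assms(1)]])
    (use assms(2) in \<open>auto simp: U_def\<close>)

lemma smooth_on_chart_inverse:
  assumes "smooth_on V S f" "\<And>x. x \<in> S \<Longrightarrow> f x \<in> W"
  shows "smooth_on V S (\<lambda>x. g \<odot> cayley (f x))"
  by (intro smooth_on_mul smooth_on_const smooth_on_cayley assms(1))
    (use assms(2) in \<open>auto simp: W_def\<close>)

lemma continuous_on_\<phi>: "continuous_on (U g) (\<phi> g)"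
  unfolding \<phi>_def
  by (intro continuous_on_cayley continuous_on_mul continuous_intros) (auto simp: U_def)

lemma continuous_on_chart_inverse: "continuous_on W (\<lambda>y. g \<odot> cayley y)"
  by (intro continuous_on_cayley continuous_on_mul continuous_intros) (auto simp: W_def)

lemma is_chart_\<phi>:
  assumes g: "g \<in> G"
  shows "is_chart skew (top_of_set G) (U g, \<phi> g)"
proof -
  have "U g \<subseteq> G" by (auto simp: U_def)
  have "homeomorphic_maps (top_of_set (U g)) (top_of_set W) (\<phi> g) (\<lambda>y. g \<odot> cayley y)"
    unfolding homeomorphic_maps_def
    using continuous_on_\<phi> continuous_on_chart_inverse \<phi>_W [OF g] chart_inverse_U [OF g]
      chart_inverse_left [OF g] chart_inverse_right [OF g]
    by (auto simp: continuous_map_subtopology_eu)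
  then have "homeomorphic_map (top_of_set (U g)) (top_of_set W) (\<phi> g)"
    by (rule homeomorphic_maps_map [THEN iffD1, THEN conjunct1])
  then show ?thesis
    using \<open>U g \<subseteq> G\<close> openin_U openin_W
    by (simp add: is_chart_def \<phi>_image g subtopology_subtopology Int_absorb1)
qed

lemma topology_G: "Hausdorff_space (top_of_set G)" "second_countable (top_of_set G)"
proof -
  obtain \<B> :: "'e set set" where "countable \<B>" "topological_basis \<B>"
    using ex_countable_basis by blast
  then have "second_countable (euclidean :: 'e topology)"
    unfolding second_countable_def
    by (metis open_openin topological_basisE topological_basis_open)
  then show "second_countable (top_of_set G)" by (rule second_countable_subtopology)
qed (auto intro: Hausdorff_space_subtopology)

lemma smooth_manifold_G: "smooth_manifold skew (top_of_set G) atlas"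
proof -
  have "(\<Union>(U, \<phi>)\<in>atlas. U) = G"
  proof -
    \<comment> \<open>In the chart at \<open>g\<close> the point \<open>g\<close> has \<open>e + star g \<odot> g = 2 e\<close>.\<close>
    have "g \<in> U g" if "g \<in> G" for g
      using that unit_scaleR [of e 2] by (simp add: U_def star_G scaleR_2)
    moreover have "U g \<subseteq> G" for g by (auto simp: U_def)
    ultimately show ?thesis by (fastforce simp: atlas_def)
  qed
  moreover have "smooth_on skew (\<phi> g ` (U g \<inter> U h)) (\<phi> h \<circ> inv_into (U g) (\<phi> g))"
    if "g \<in> G" "h \<in> G" for g h
  proof (rule smooth_on_cong)
    show "smooth_on skew (\<phi> g ` (U g \<inter> U h)) (\<lambda>y. \<phi> h (g \<odot> cayley y))"
      using that by (intro smooth_on_\<phi> smooth_on_chart_inverse smooth_on_bounded_linear bounded_linear_ident)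
        (auto simp: chart_inverse_left \<phi>_W)
  qed (use that in \<open>auto simp: inv_into_\<phi> \<phi>_W\<close>)
  ultimately show ?thesis
    by (auto simp: smooth_manifold_def subspace_skew topology_G atlas_def is_chart_\<phi>)
qed

lemma smooth_map_star: "smooth_map skew (top_of_set G) atlas (top_of_set G) atlas (m_inv the_group)"
proof -
  have "continuous_on G star" by (rule linear_continuous_on [OF star_bounded_linear])
  then have "continuous_map (top_of_set G) (top_of_set G) star"
    using star_in_G by (auto simp: continuous_map_subtopology_eu)
  then have "continuous_map (top_of_set G) (top_of_set G) (m_inv the_group)"
    by (rule continuous_map_eq) (simp add: m_inv_the_group)
  moreover have "smooth_on skew (\<phi> g ` {x \<in> U g. m_inv the_group x \<in> U h})
      (\<phi> h \<circ> m_inv the_group \<circ> inv_into (U g) (\<phi> g))" if "g \<in> G" "h \<in> G" for g h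
  proof -
    have G: "x \<in> G" if "x \<in> U g" for x using that by (simp add: U_def)
    show ?thesis
    proof (rule smooth_on_cong)
      show "smooth_on skew (\<phi> g ` {x \<in> U g. m_inv the_group x \<in> U h}) (\<lambda>y. \<phi> h (star (g \<odot> cayley y)))"
        using that
        by (intro smooth_on_\<phi> smooth_on_linear_comp [OF star_bounded_linear] smooth_on_chart_inverse
            smooth_on_bounded_linear bounded_linear_ident)
          (auto simp: chart_inverse_left \<phi>_W m_inv_the_group G)
    qed (use that in \<open>auto simp: inv_into_\<phi> \<phi>_W chart_inverse_left m_inv_the_group G\<close>)
  qed
  ultimately show ?thesis by (auto simp: smooth_map_def atlas_def)
qed

lemma smooth_map_mul:
  "smooth_map (skew \<times> skew) (prod_topology (top_of_set G) (top_of_set G)) (prod_atlas atlas atlas)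
     (top_of_set G) atlas (\<lambda>(x, y). x \<odot> y)"
proof -
  have "continuous_on (G \<times> G) (\<lambda>p. fst p \<odot> snd p)"
    by (intro continuous_on_mul continuous_intros)
  then have "continuous_map (prod_topology (top_of_set G) (top_of_set G)) (top_of_set G) (\<lambda>(x, y). x \<odot> y)"
    using mul_in_G by (auto simp: subtopology_Times [symmetric] continuous_map_subtopology_eu split_def)
  moreover have "smooth_on (skew \<times> skew) (map_prod (\<phi> g) (\<phi> h) ` {p \<in> U g \<times> U h. (case p of (x, y) \<Rightarrow> x \<odot> y) \<in> U k})
      (\<phi> k \<circ> (\<lambda>(x, y). x \<odot> y) \<circ> inv_into (U g \<times> U h) (map_prod (\<phi> g) (\<phi> h)))"
    if "g \<in> G" "h \<in> G" "k \<in> G" for g h k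
  proof (rule smooth_on_cong)
    let ?S = "map_prod (\<phi> g) (\<phi> h) ` {p \<in> U g \<times> U h. (case p of (x, y) \<Rightarrow> x \<odot> y) \<in> U k}"
    show "smooth_on (skew \<times> skew) ?S (\<lambda>p. \<phi> k ((g \<odot> cayley (fst p)) \<odot> (h \<odot> cayley (snd p))))"
      using that
      by (intro smooth_on_\<phi> smooth_on_mul [of _ _ "\<lambda>p. g \<odot> cayley (fst p)"] smooth_on_chart_inverse
          smooth_on_bounded_linear bounded_linear_fst bounded_linear_snd)
        (auto simp: chart_inverse_left \<phi>_W)
    show "\<phi> k ((g \<odot> cayley (fst p)) \<odot> (h \<odot> cayley (snd p)))
        = (\<phi> k \<circ> (\<lambda>(x, y). x \<odot> y) \<circ> inv_into (U g \<times> U h) (map_prod (\<phi> g) (\<phi> h))) p" if p: "p \<in> ?S" for p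
    proof -
      obtain x y where xy: "x \<in> U g" "y \<in> U h" "p = (\<phi> g x, \<phi> h y)" using p by auto
      have "inj_on (map_prod (\<phi> g) (\<phi> h)) (U g \<times> U h)"
        by (rule map_prod_inj_on [OF inj_\<phi> inj_\<phi>]) fact+
      then have "inv_into (U g \<times> U h) (map_prod (\<phi> g) (\<phi> h)) p = (x, y)"
        by (rule inv_into_f_eq) (simp_all add: xy)
      then show ?thesis by (simp add: xy chart_inverse_left \<open>g \<in> G\<close> \<open>h \<in> G\<close>)
    qed
  qed
  ultimately show ?thesis
    by (auto simp: smooth_map_def prod_atlas_def atlas_def)
qed

theorem lie_group_G: "lie_group skew atlas (top_of_set G) the_group"
  using group_the_group smooth_manifold_G smooth_map_star smooth_map_mul
  by (simp add: lie_group_def the_group_def)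

end

section \<open>Square matrices over a finite-dimensional algebra\<close>

lemma matrix_mul_bilinear:
  "bounded_bilinear ((**) :: 'a::{real_algebra_1,euclidean_space} ^ 'n ^ 'm \<Rightarrow> 'a ^ 'p ^ 'n \<Rightarrow> 'a ^ 'p ^ 'm)"
proof -
  have "bilinear ((**) :: 'a ^ 'n ^ 'm \<Rightarrow> 'a ^ 'p ^ 'n \<Rightarrow> 'a ^ 'p ^ 'm)"
    unfolding bilinear_def
    by (auto intro!: linearI simp: matrix_matrix_mult_def vec_eq_iff distrib_left distrib_right
        sum.distrib scaleR_sum_right)
  then show ?thesis by (simp add: bilinear_conv_bounded_bilinear)
qed

lemmas matrix_mul_simps =
  bounded_bilinear.add_left [OF matrix_mul_bilinear] bounded_bilinear.add_right [OF matrix_mul_bilinear]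
  bounded_bilinear.diff_left [OF matrix_mul_bilinear] bounded_bilinear.diff_right [OF matrix_mul_bilinear]
  bounded_bilinear.minus_left [OF matrix_mul_bilinear] bounded_bilinear.minus_right [OF matrix_mul_bilinear]
  bounded_bilinear.scaleR_left [OF matrix_mul_bilinear] bounded_bilinear.scaleR_right [OF matrix_mul_bilinear]
  bounded_bilinear.zero_left [OF matrix_mul_bilinear] bounded_bilinear.zero_right [OF matrix_mul_bilinear]

interpretation matrix_algebra: fin_dim_algebra
  "(**) :: 'a::{real_algebra_1,euclidean_space} ^ 'n ^ 'n \<Rightarrow> 'a ^ 'n ^ 'n \<Rightarrow> 'a ^ 'n ^ 'n" "mat 1"
  by (rule fin_dim_algebra.intro) (simp_all add: matrix_mul_bilinear matrix_mul_assoc)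

text \<open>Translate the path to \<open>B\<close> by \<open>A\<close> and append it to the path to \<open>A\<close>.\<close>

lemma path_component_product:
  fixes S :: "('a::{real_algebra_1,euclidean_space} ^ 'n ^ 'n) set"
  assumes S: "\<And>A B. A \<in> S \<Longrightarrow> B \<in> S \<Longrightarrow> A ** B \<in> S"
    and A: "path_component S (mat 1) A" and B: "path_component S (mat 1) B"
  shows "path_component S (mat 1) (A ** B)"
proof -
  have "A \<in> S" using A path_component_mem by blast
  obtain g where g: "path g" "path_image g \<subseteq> S" "pathstart g = mat 1" "pathfinish g = B"
    using B by (auto simp: path_component_def)
  have "path ((\<lambda>X. A ** X) \<circ> g)"
    by (intro path_continuous_image g matrix_algebra.continuous_on_mul continuous_intros)
  moreover have "path_image ((\<lambda>X. A ** X) \<circ> g) \<subseteq> S"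
    using g(2) S \<open>A \<in> S\<close> by (auto simp: path_image_compose)
  ultimately have "path_component S A (A ** B)"
    unfolding path_component_def using g(3,4)
    by (intro exI [of _ "(\<lambda>X. A ** X) \<circ> g"]) (simp add: pathstart_compose pathfinish_compose)
  then show ?thesis by (rule path_component_trans [OF A])
qed

lemma path_componentI_continuous:
  fixes h :: "real \<Rightarrow> 'a::topological_space"
  assumes "continuous_on {0..1} h" "\<And>t. t \<in> {0..1} \<Longrightarrow> h t \<in> S"
  shows "path_component S (h 0) (h 1)"
  unfolding path_component_def
  by (intro exI [of _ h]) (use assms in \<open>auto simp: path_def path_image_def pathstart_def pathfinish_def\<close>)


lemma matrix_vector_mult_uminus: "(- A) *v x = - (A *v x)" for A :: "real ^ 'n ^ 'm"
  by (simp add: matrix_vector_mult_def vec_eq_iff sum_negf)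

lemma matrix_eq_1I:
  fixes A :: "real ^ 'n ^ 'n"
  assumes "\<And>i. A *v axis i 1 = axis i 1"
  shows "A = mat 1"
proof -
  have "column i A = axis i 1" for i using assms [of i] by (simp add: matrix_vector_mult_basis)
  then have "A $ r $ i = axis i 1 $ r" for r i by (simp add: column_def vec_eq_iff)
  then show ?thesis by (simp add: vec_eq_iff mat_def axis_def)
qed


section \<open>The special orthogonal group is connected\<close>

definition reflection :: "real ^ 'n \<Rightarrow> real ^ 'n ^ 'n" where
  "reflection v = (\<chi> i j. (if i = j then 1 else 0) - 2 * v $ i * v $ j / (v \<bullet> v))"

lemma reflection_mult_vector: "reflection v *v x = x - (2 * (v \<bullet> x) / (v \<bullet> v)) *\<^sub>R v"
proof -
  have "(\<Sum>j\<in>UNIV. ((if i = j then 1 else 0) - 2 * v $ i * v $ j / (v \<bullet> v)) * x $ j)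
      = x $ i - 2 * (v \<bullet> x) / (v \<bullet> v) * v $ i" for i
  proof -
    have "(\<Sum>j\<in>UNIV. ((if i = j then 1 else 0) - 2 * v $ i * v $ j / (v \<bullet> v)) * x $ j)
        = (\<Sum>j\<in>UNIV. (if i = j then x $ j else 0) - 2 * v $ i / (v \<bullet> v) * (v $ j * x $ j))"
      by (rule sum.cong) (auto simp: algebra_simps)
    also have "\<dots> = x $ i - 2 * v $ i / (v \<bullet> v) * (\<Sum>j\<in>UNIV. v $ j * x $ j)"
      by (simp add: sum_subtractf sum_distrib_left sum_divide_distrib)
    finally show ?thesis by (simp add: inner_vec_def)
  qed
  then show ?thesis
    by (simp add: reflection_def matrix_vector_mult_def vec_eq_iff)
qed

lemma transpose_reflection: "transpose (reflection v) = reflection v"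
  by (simp add: transpose_def reflection_def vec_eq_iff mult_ac)

lemma reflection_involution:
  assumes "v \<noteq> 0"
  shows "reflection v ** reflection v = mat 1"
proof (rule matrix_eq [THEN iffD2, rule_format])
  fix x
  show "reflection v ** reflection v *v x = mat 1 *v x"
  proof -
    define a where "a = 2 * (v \<bullet> x) / (v \<bullet> v)"
    have "2 * (v \<bullet> (x - a *\<^sub>R v)) / (v \<bullet> v) = - a"
      using assms by (simp add: a_def inner_diff_right field_simps)
    then show ?thesis
      by (simp add: reflection_mult_vector flip: matrix_vector_mul_assoc a_def)
  qed
qed

lemma orthogonal_matrix_inner:
  fixes A :: "real ^ 'n ^ 'n"
  assumes "orthogonal_matrix A"
  shows "(A *v x) \<bullet> (A *v y) = x \<bullet> y"
proof -
  have "orthogonal_transformation ((*v) A)"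
    using assms by (simp add: orthogonal_transformation_matrix)
  then show ?thesis by (simp add: orthogonal_transformation_def)
qed

lemma orthogonal_reflection: "v \<noteq> 0 \<Longrightarrow> orthogonal_matrix (reflection v)"
  by (simp add: orthogonal_matrix_def transpose_reflection reflection_involution)

lemma reflection_minus: "reflection (- v) = reflection v"
  by (simp add: reflection_def)

text \<open>All reflections are conjugate to the reflection in a coordinate hyperplane.\<close>

lemma det_reflection:
  fixes v :: "real ^ 'n"
  assumes "v \<noteq> 0"
  shows "det (reflection v) = - 1"
proof -
  define w where "w = (1 / norm v) *\<^sub>R v"
  have "norm w = 1" using assms by (simp add: w_def)
  then obtain A :: "real ^ 'n ^ 'n" and k where A: "orthogonal_matrix A" "A *v axis k 1 = w"
    using orthogonal_matrix_exists_basis by metis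
  define D :: "real ^ 'n ^ 'n" where "D = reflection (axis k 1)"
  have AtA: "transpose A ** A = mat 1" "A ** transpose A = mat 1"
    using A(1) by (auto simp: orthogonal_matrix_def)
  have "reflection v ** A = A ** D"
  proof (rule matrix_eq [THEN iffD2, rule_format])
    fix x
    have w: "w \<bullet> (A *v x) = axis k 1 \<bullet> x"
      unfolding A(2) [symmetric] by (rule orthogonal_matrix_inner [OF A(1)])
    have v: "v = norm v *\<^sub>R w" using assms by (simp add: w_def)
    have "(2 * (r *\<^sub>R w \<bullet> (A *v x)) / (r * r)) *\<^sub>R (r *\<^sub>R w) = (2 * (axis k 1 \<bullet> x)) *\<^sub>R w"
      if "r \<noteq> 0" for r
      using that by (simp add: w)
    from this [of "norm v"] have "(2 * (v \<bullet> (A *v x)) / (v \<bullet> v)) *\<^sub>R v = (2 * (axis k 1 \<bullet> x)) *\<^sub>R w"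
      using assms by (simp flip: v add: dot_square_norm power2_eq_square)
    then show "reflection v ** A *v x = A ** D *v x"
      by (simp add: D_def reflection_mult_vector matrix_vector_mult_diff_distrib matrix_vector_mult_scaleR A(2)
          flip: matrix_vector_mul_assoc)
  qed
  then have "det (reflection v) * det A = det A * det D" by (metis det_mul)
  moreover have "det A \<noteq> 0" by (metis AtA(1) det_I det_mul mult_zero_right zero_neq_one)
  moreover have D: "D $ i $ j = (if i = j then if i = k then - 1 else 1 else 0)" for i j
    by (simp add: D_def reflection_def inner_axis_axis) (simp add: axis_def)
  moreover have "det D = (\<Prod>i\<in>UNIV. D $ i $ i)"
    by (rule det_diagonal) (simp add: D)
  moreover have "(\<Prod>i\<in>UNIV. D $ i $ i) = (\<Prod>i\<in>UNIV. if i = k then - 1 else 1)"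
    by (rule prod.cong) (simp_all add: D)
  ultimately have "det (reflection v) * det A = - 1 * det A" "det A \<noteq> 0" by (simp_all add: prod.delta)
  then show ?thesis by (metis mult_right_cancel)
qed

definition special_orthogonal :: "(real ^ 'n ^ 'n) set" where
  "special_orthogonal = {A. transpose A ** A = mat 1 \<and> det A = 1}"

lemma special_orthogonal_mult:
  "A \<in> special_orthogonal \<Longrightarrow> B \<in> special_orthogonal \<Longrightarrow> A ** B \<in> special_orthogonal"
  using orthogonal_matrix_mul by (auto simp: special_orthogonal_def det_mul orthogonal_matrix)

lemma reflection_pair_in_special_orthogonal:
  assumes "v \<noteq> 0" "w \<noteq> 0"
  shows "reflection v ** reflection w \<in> special_orthogonal"
  using orthogonal_matrix_mul [OF orthogonal_reflection orthogonal_reflection] assms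
  by (auto simp: special_orthogonal_def det_mul det_reflection orthogonal_matrix)

text \<open>Turning the first mirror into the second one contracts a product of two reflections
  to the identity. After a change of the sign of \<open>v\<close>, which does not affect its mirror,
  the segment between the two normal vectors avoids zero.\<close>

lemma path_component_reflection_pair:
  fixes v w :: "real ^ 'n"
  assumes v: "v \<noteq> 0" and w: "w \<noteq> 0"
  shows "path_component special_orthogonal (mat 1) (reflection v ** reflection w)"
proof -
  have *: "path_component special_orthogonal (mat 1) (reflection v ** reflection w)"
    if v: "v \<noteq> 0" and vw: "v \<bullet> w \<ge> 0" for v :: "real ^ 'n"
  proof -
    let ?u = "\<lambda>t::real. t *\<^sub>R v + (1 - t) *\<^sub>R w"
    have nz: "?u t \<noteq> 0" if "t \<in> {0..1}" for t
    proof
      assume "?u t = 0"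
      then have "v \<bullet> ?u t = 0" "?u t \<bullet> w = 0" by (simp_all only: inner_zero_left inner_zero_right)
      then have "t * (v \<bullet> v) + (1 - t) * (v \<bullet> w) = 0" "t * (v \<bullet> w) + (1 - t) * (w \<bullet> w) = 0"
        by (simp_all add: inner_add_left inner_add_right)
      moreover have "t * (v \<bullet> v) \<ge> 0" "(1 - t) * (v \<bullet> w) \<ge> 0" "t * (v \<bullet> w) \<ge> 0" "(1 - t) * (w \<bullet> w) \<ge> 0"
        using that vw by auto
      ultimately have "t * (v \<bullet> v) = 0" "(1 - t) * (w \<bullet> w) = 0" by linarith+
      with v w show False by simp
    qed
    have "continuous_on {0..1} (\<lambda>t. reflection (?u t))"
      unfolding reflection_def
      by (intro continuous_intros) (use nz in auto)
    then have "continuous_on {0..1} (\<lambda>t. reflection (?u t) ** reflection w)"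
      by (intro matrix_algebra.continuous_on_mul continuous_intros)
    then have "path_component special_orthogonal (reflection (?u 0) ** reflection w) (reflection (?u 1) ** reflection w)"
      by (rule path_componentI_continuous) (auto intro!: reflection_pair_in_special_orthogonal nz w)
    then show ?thesis by (simp add: reflection_involution w)
  qed
  show ?thesis
    using * [of v] * [of "- v"] v by (cases "v \<bullet> w \<ge> 0") (auto simp: reflection_minus)
qed

text \<open>Reflections move \<open>A\<close> towards the identity one basis vector at a time. The determinant tells
  whether their number is even.\<close>

lemma path_component_special_orthogonal:
  fixes A :: "real ^ 'n ^ 'n"
  assumes "A \<in> special_orthogonal"
  shows "path_component special_orthogonal (mat 1) A"
proof -
  let ?P = "\<lambda>A :: real ^ 'n ^ 'n. path_component special_orthogonal (mat 1) A"
  \<comment> \<open>Up to at most one reflection, \<open>A\<close> is connected with the identity.\<close>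
  let ?K = "\<lambda>A :: real ^ 'n ^ 'n. ?P A \<or> (\<exists>v. v \<noteq> 0 \<and> ?P (reflection v ** A))"
  have one: "?P (mat 1)" by (rule path_component_refl) (simp add: special_orthogonal_def)
  have step: "?K A" if v: "v \<noteq> 0" and K: "?K (reflection v ** A)" for v :: "real ^ 'n" and A
    using K
  proof
    assume "\<exists>w. w \<noteq> 0 \<and> ?P (reflection w ** (reflection v ** A))"
    then obtain w where w: "w \<noteq> 0" "?P (reflection w ** (reflection v ** A))" by blast
    have "?P (reflection v ** reflection w ** (reflection w ** (reflection v ** A)))"
      by (intro path_component_product special_orthogonal_mult path_component_reflection_pair v w)
    moreover have "reflection v ** reflection w ** (reflection w ** (reflection v ** A))
        = reflection v ** (reflection w ** reflection w) ** reflection v ** A"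
      by (simp only: matrix_mul_assoc)
    ultimately show ?thesis by (simp add: reflection_involution v w)
  qed (use v in blast)
  have "?K A" if "orthogonal_matrix A" "\<forall>i. i \<notin> S \<longrightarrow> A *v axis i 1 = axis i 1" for A and S :: "'n set"
    using finite [of S] that
  proof (induction S arbitrary: A rule: finite_induct)
    case empty
    then have "A = mat 1" by (intro matrix_eq_1I) simp
    then show ?case using one by simp
  next
    case (insert j S)
    have inner: "(A *v x) \<bullet> (A *v y) = x \<bullet> y" for x y
      by (rule orthogonal_matrix_inner [OF insert.prems(1)])
    show ?case
    proof (cases "A *v axis j 1 = axis j 1")
      case True
      then show ?thesis using insert by (metis insertE)
    next
      case False
      \<comment> \<open>The reflection that exchanges the unit vectors \<open>A *v axis j 1\<close> and \<open>axis j 1\<close>.\<close>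
      define v where "v = A *v axis j 1 - axis j 1"
      have v: "v \<noteq> 0" using False by (simp add: v_def)
      have "reflection v ** A *v axis i 1 = axis i 1" if "i \<notin> S" for i
      proof (cases "i = j")
        case True
        have "v \<bullet> v = 2 * (v \<bullet> (A *v axis j 1))"
          by (simp add: v_def inner_diff_left inner_diff_right inner inner_commute)
        then have "2 * (v \<bullet> (A *v axis j 1)) / (v \<bullet> v) = 1" using v by (metis div_self inner_eq_zero_iff)
        then have "reflection v *v (A *v axis j 1) = A *v axis j 1 - v"
          by (simp only: reflection_mult_vector scaleR_one)
        then show ?thesis
          by (simp add: True v_def flip: matrix_vector_mul_assoc)
      next
        case False
        then have i: "A *v axis i 1 = axis i 1" using that insert.prems(2) by simp
        have "v \<bullet> (A *v axis i 1) = 0"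
          by (simp add: v_def inner_diff_left inner) (simp add: i inner_axis_axis)
        then show ?thesis
          by (simp add: reflection_mult_vector i flip: matrix_vector_mul_assoc)
      qed
      then have "?K (reflection v ** A)"
        by (intro insert.IH orthogonal_matrix_mul orthogonal_reflection v insert.prems) auto
      then show ?thesis by (rule step [OF v])
    qed
  qed
  from this [of A UNIV] assms have "?K A" by (simp add: special_orthogonal_def orthogonal_matrix)
  moreover have False if "v \<noteq> 0" "?P (reflection v ** A)" for v
    using path_component_mem(2) [OF that(2)] assms
    by (simp add: special_orthogonal_def det_mul det_reflection that(1))
  ultimately show ?thesis by blast
qed


section \<open>The real symplectic group is connected\<close>

definition Omega_real :: "real ^ ('n::finite \<times> bool) ^ ('n \<times> bool)" where
  "Omega_real = (\<chi> r s. if fst r = fst s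
     then (if \<not> snd r \<and> snd s then 1 else if snd r \<and> \<not> snd s then - 1 else 0) else 0)"

definition symplectic :: "(real ^ ('n::finite \<times> bool) ^ ('n \<times> bool)) set" where
  "symplectic = {A. transpose A ** Omega_real ** A = Omega_real}"

definition \<omega> :: "real ^ ('n::finite \<times> bool) \<Rightarrow> real ^ ('n \<times> bool) \<Rightarrow> real" where
  "\<omega> x y = x \<bullet> (Omega_real *v y)"

lemma transpose_Omega_real: "transpose Omega_real = - Omega_real"
  by (auto simp: transpose_def Omega_real_def vec_eq_iff)

lemma \<omega>_linear:
  "\<omega> (x + x') y = \<omega> x y + \<omega> x' y" "\<omega> x (y + y') = \<omega> x y + \<omega> x y'"
  "\<omega> (x - x') y = \<omega> x y - \<omega> x' y" "\<omega> x (y - y') = \<omega> x y - \<omega> x y'"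
  "\<omega> (c *\<^sub>R x) y = c * \<omega> x y" "\<omega> x (c *\<^sub>R y) = c * \<omega> x y"
  by (simp_all add: \<omega>_def inner_add_left inner_add_right inner_diff_left inner_diff_right
      matrix_vector_right_distrib matrix_vector_mult_diff_distrib matrix_vector_mult_scaleR)

lemma inner_matrix_vector: "x \<bullet> (A *v y) = (transpose A *v x) \<bullet> (y :: real ^ 'n)"
  by (simp add: dot_lmul_matrix transpose_matrix_vector)

lemma \<omega>_antisym: "\<omega> y x = - \<omega> x y"
  unfolding \<omega>_def inner_matrix_vector [of y] transpose_Omega_real
  by (simp add: inner_commute matrix_vector_mult_uminus)

lemma \<omega>_self [simp]: "\<omega> x x = 0"
  using \<omega>_antisym [of x x] by simp

lemma \<omega>_axis_axis: "\<omega> (axis r 1) (axis s 1) = Omega_real $ r $ s"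
  by (simp add: \<omega>_def inner_axis' matrix_vector_mult_basis column_def)

lemma symplectic_iff: "A \<in> symplectic \<longleftrightarrow> (\<forall>x y. \<omega> (A *v x) (A *v y) = \<omega> x y)"
proof -
  have *: "\<omega> (A *v x) (A *v y) = x \<bullet> ((transpose A ** Omega_real ** A) *v y)" for x y
    by (simp only: \<omega>_def inner_matrix_vector [of x "transpose A"] transpose_transpose
        flip: matrix_vector_mul_assoc)
  show ?thesis
  proof
    assume R: "\<forall>x y. \<omega> (A *v x) (A *v y) = \<omega> x y"
    have "(transpose A ** Omega_real ** A) $ r $ s = Omega_real $ r $ s" for r s
      using R [rule_format, of "axis r 1" "axis s 1"] unfolding * \<omega>_axis_axis
      by (simp add: inner_axis' matrix_vector_mult_basis column_def)
    then show "A \<in> symplectic" by (simp add: symplectic_def vec_eq_iff)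
  next
    assume "A \<in> symplectic"
    then show "\<forall>x y. \<omega> (A *v x) (A *v y) = \<omega> x y"
      unfolding * by (simp add: symplectic_def \<omega>_def)
  qed
qed

lemma symplectic_mult: "A \<in> symplectic \<Longrightarrow> B \<in> symplectic \<Longrightarrow> A ** B \<in> symplectic"
  by (simp add: symplectic_iff flip: matrix_vector_mul_assoc)

lemma one_symplectic: "mat 1 \<in> symplectic"
  by (simp add: symplectic_iff)

definition transvection :: "real \<Rightarrow> real ^ ('n::finite \<times> bool) \<Rightarrow> real ^ ('n \<times> bool) ^ ('n \<times> bool)" where
  "transvection c v = mat 1 + c *\<^sub>R (\<chi> i j. v $ i * (transpose Omega_real *v v) $ j)"

lemma transvection_mult_vector: "transvection c v *v x = x + (c * \<omega> v x) *\<^sub>R v"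
proof -
  have "(\<chi> i j. v $ i * w $ j) *v x = (w \<bullet> x) *\<^sub>R v" for w
    by (simp add: matrix_vector_mult_def inner_vec_def vec_eq_iff sum_distrib_left mult_ac)
  then have "transvection c v *v x = x + c *\<^sub>R (((transpose Omega_real *v v) \<bullet> x) *\<^sub>R v)"
    by (simp add: transvection_def matrix_vector_mult_add_rdistrib scaleR_matrix_vector_assoc [symmetric])
  then show ?thesis by (simp add: \<omega>_def inner_matrix_vector)
qed

lemma transvection_symplectic: "transvection c v \<in> symplectic"
  by (simp add: symplectic_iff transvection_mult_vector \<omega>_linear) (simp add: \<omega>_antisym [of v])

lemma transvection_inverse: "transvection (- c) v ** transvection c v = mat 1"
  by (rule matrix_eq [THEN iffD2])
    (simp add: transvection_mult_vector \<omega>_linear flip: matrix_vector_mul_assoc)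

lemma path_component_transvection: "path_component symplectic (mat 1) (transvection c v)"
proof -
  have "continuous_on {0..1} (\<lambda>t. transvection (t * c) v)"
    unfolding transvection_def by (intro continuous_intros)
  then have "path_component symplectic (transvection (0 * c) v) (transvection (1 * c) v)"
    by (rule path_componentI_continuous) (rule transvection_symplectic)
  then show ?thesis by (simp add: transvection_def)
qed

text \<open>A transvection along the difference of two vectors moves one to the other, unless they are
  orthogonal.\<close>

lemma transvection_exchange:
  assumes "\<omega> u w \<noteq> 0"
  shows "transvection (1 / \<omega> w u) (w - u) *v u = w"
  using assms by (simp add: transvection_mult_vector \<omega>_linear \<omega>_antisym [of u w])

lemma \<omega>_nondegenerate:
  assumes "x \<noteq> 0"
  obtains r where "\<omega> x (axis r 1) \<noteq> 0"
proof -
  obtain i b where ib: "x $ (i, b) \<noteq> 0" using assms by (auto simp: vec_eq_iff)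
  have "\<omega> (axis (i, \<not> b) 1) x = (\<Sum>s\<in>UNIV. Omega_real $ (i, \<not> b) $ s * x $ s)"
    by (simp add: \<omega>_def inner_axis' matrix_vector_mult_def)
  also have "\<dots> = (\<Sum>s\<in>UNIV. if s = (i, b) then Omega_real $ (i, \<not> b) $ (i, b) * x $ (i, b) else 0)"
    by (rule sum.cong) (auto simp: Omega_real_def)
  also have "\<dots> \<noteq> 0" using ib by (auto simp: Omega_real_def)
  finally show ?thesis using that \<omega>_antisym by (metis neg_equal_0_iff_equal)
qed

text \<open>Transvections move \<open>A\<close> towards the identity one hyperbolic plane at a time. The vectors
  along which they are taken are orthogonal to the planes that \<open>A\<close> already fixes; they lie in the space
  \<open>X\<close> of the proof. In the plane of \<open>j\<close>, the vector \<open>?e\<close> is corrected first and then \<open>?f\<close>, each by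
  one transvection, or by two with an intermediate vector if the vector and its image are orthogonal.\<close>

lemma path_component_symplectic:
  fixes A :: "real ^ ('n::finite \<times> bool) ^ ('n \<times> bool)"
  assumes "A \<in> symplectic"
  shows "path_component symplectic (mat 1) A"
proof -
  let ?P = "\<lambda>A :: real ^ ('n \<times> bool) ^ ('n \<times> bool). path_component symplectic (mat 1) A"
  have step: "?P A" if "?P (transvection c v ** A)" for c v A
  proof -
    have "?P (transvection (- c) v ** (transvection c v ** A))"
      by (intro path_component_product symplectic_mult path_component_transvection that)
    then show ?thesis by (simp add: matrix_mul_assoc transvection_inverse)
  qed
  have "?P A" if "A \<in> symplectic" "\<forall>i b. i \<notin> S \<longrightarrow> A *v axis (i, b) 1 = axis (i, b) 1" for A and S :: "'n set"
    using finite [of S] that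
  proof (induction S arbitrary: A rule: finite_induct)
    case empty
    then have "A = mat 1" by (intro matrix_eq_1I) auto
    then show ?case using path_component_refl [OF one_symplectic] by simp
  next
    case (insert j S)
    define X where "X = {x. \<forall>i b. i \<notin> insert j S \<longrightarrow> \<omega> x (axis (i, b) 1) = 0}"
    define F where "F = {A \<in> symplectic. \<forall>i b. i \<notin> insert j S \<longrightarrow> A *v axis (i, b) 1 = axis (i, b) 1}"
    let ?e = "axis (j, False) 1 :: real ^ ('n \<times> bool)" and ?f = "axis (j, True) 1 :: real ^ ('n \<times> bool)"
    have X_diff: "x - y \<in> X" if "x \<in> X" "y \<in> X" for x y using that by (simp add: X_def \<omega>_linear)
    have X_add: "x + y \<in> X" if "x \<in> X" "y \<in> X" for x y using that by (simp add: X_def \<omega>_linear)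
    have X_axis: "axis (i, b) 1 \<in> X" if "i \<in> insert j S" for i b
      using that by (auto simp: X_def \<omega>_axis_axis Omega_real_def)
    have F_X: "A *v x \<in> X" if "A \<in> F" "x \<in> X" for A x
    proof -
      have "\<omega> (A *v x) (axis (i, b) 1) = 0" if "i \<notin> insert j S" for i b
      proof -
        have "\<omega> (A *v x) (A *v axis (i, b) 1) = \<omega> x (axis (i, b) 1)"
          using \<open>A \<in> F\<close> by (simp add: F_def symplectic_iff)
        then show ?thesis using \<open>A \<in> F\<close> \<open>x \<in> X\<close> that by (simp add: F_def X_def)
      qed
      then show ?thesis by (simp add: X_def)
    qed
    have T_F: "transvection c v ** A \<in> F" if "A \<in> F" "v \<in> X" for c v A
      using that by (auto simp: F_def X_def symplectic_mult transvection_symplectic transvection_mult_vector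
          simp flip: matrix_vector_mul_assoc)
    have ef: "\<omega> ?e ?f = 1" by (simp add: \<omega>_axis_axis Omega_real_def)
    have fixed_plane: "?P A" if A: "A \<in> F" "A *v ?e = ?e" "A *v ?f = ?f" for A
    proof (rule insert.IH)
      show "\<forall>i b. i \<notin> S \<longrightarrow> A *v axis (i, b) 1 = axis (i, b) 1"
        using A by (auto simp: F_def) (metis (full_types))
    qed (use A F_def in auto)
    have fixed_e1: "?P A" if A: "A \<in> F" "A *v ?e = ?e" and f: "\<omega> (A *v ?f) ?f \<noteq> 0" for A
    proof (rule step)
      let ?v = "?f - A *v ?f"
      \<comment> \<open>The transvection along \<open>?v\<close> moves \<open>A *v ?f\<close> to \<open>?f\<close> and does not disturb \<open>?e\<close>.\<close>
      have "\<omega> ?e (A *v ?f) = 1" using A ef by (metis (no_types, lifting) F_def mem_Collect_eq symplectic_iff)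
      then have "\<omega> ?v ?e = 0"
        using ef \<omega>_antisym [of ?f ?e] \<omega>_antisym [of "A *v ?f" ?e] by (simp add: \<omega>_linear)
      then show "?P (transvection (1 / \<omega> ?f (A *v ?f)) ?v ** A)"
        using A f by (intro fixed_plane T_F X_diff F_X X_axis)
          (simp_all add: transvection_exchange transvection_mult_vector [of _ _ ?e] flip: matrix_vector_mul_assoc)
    qed
    have fixed_e: "?P A" if A: "A \<in> F" "A *v ?e = ?e" for A
    proof (cases "\<omega> (A *v ?f) ?f = 0")
      case True
      \<comment> \<open>The intermediate vector \<open>A *v ?f - ?e\<close> is not orthogonal to \<open>?f\<close>.\<close>
      have eAf: "\<omega> ?e (A *v ?f) = 1"
        using A ef by (metis (no_types, lifting) F_def mem_Collect_eq symplectic_iff)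
      then have *: "transvection (- 1) ?e ** A *v ?f = A *v ?f - ?e"
        by (simp add: transvection_mult_vector flip: matrix_vector_mul_assoc)
      show ?thesis
      proof (rule step)
        show "?P (transvection (- 1) ?e ** A)"
        proof (rule fixed_e1)
          show "transvection (- 1) ?e ** A \<in> F" by (intro T_F A X_axis) simp
          show "transvection (- 1) ?e ** A *v ?e = ?e"
            by (simp add: A transvection_mult_vector flip: matrix_vector_mul_assoc)
          show "\<omega> (transvection (- 1) ?e ** A *v ?f) ?f \<noteq> 0"
            unfolding * by (simp add: \<omega>_linear True ef)
        qed
      qed
    qed (use fixed_e1 A in blast)
    have move1: "?P A" if A: "A \<in> F" and e: "\<omega> (A *v ?e) ?e \<noteq> 0" for A
      by (rule step, rule fixed_e [of "transvection (1 / \<omega> ?e (A *v ?e)) (?e - A *v ?e) ** A"])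
        (use A e in \<open>auto intro!: T_F X_diff F_X X_axis simp: transvection_exchange simp flip: matrix_vector_mul_assoc\<close>)
    have A: "A \<in> F" using insert.prems by (auto simp: F_def)
    define u where "u = A *v ?e"
    have "u \<in> X" unfolding u_def by (intro F_X A X_axis) simp
    have "\<omega> u (A *v ?f) = 1" using A ef by (simp add: u_def F_def symplectic_iff)
    then have "u \<noteq> 0" by (auto simp: \<omega>_def)
    show ?case
    proof (cases "\<omega> u ?e = 0")
      case False
      then show ?thesis using move1 A by (simp add: u_def)
    next
      case True
      \<comment> \<open>A vector \<open>z\<close> of \<open>X\<close> that is orthogonal neither to \<open>u\<close> nor to \<open>?e\<close>.\<close>
      obtain i b where a: "\<omega> u (axis (i, b) 1) \<noteq> 0" using \<omega>_nondegenerate [OF \<open>u \<noteq> 0\<close>] by (metis surj_pair)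
      then have "i \<in> insert j S" using \<open>u \<in> X\<close> by (auto simp: X_def)
      then have aX: "axis (i, b) 1 \<in> X" by (rule X_axis)
      have fX: "?f \<in> X" by (rule X_axis) simp
      have fe: "\<omega> ?f ?e = - 1" using ef \<omega>_antisym by metis
      have "\<exists>z\<in>X. \<omega> u z \<noteq> 0 \<and> \<omega> z ?e \<noteq> 0"
      proof (cases "\<omega> (axis (i, b) 1) ?e = 0")
        case ae: True
        show ?thesis
        proof (cases "\<omega> u ?f = 0")
          case True
          with a ae aX fX fe show ?thesis
            by (intro bexI [of _ "axis (i, b) 1 + ?f"]) (simp_all add: \<omega>_linear X_add)
        qed (use fX fe in auto)
      qed (use a aX in auto)
      then obtain z where z: "z \<in> X" "\<omega> u z \<noteq> 0" "\<omega> z ?e \<noteq> 0" by blast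
      let ?T = "transvection (1 / \<omega> z u) (z - u)"
      have "?T ** A *v ?e = z"
        using transvection_exchange [OF z(2)] by (simp add: u_def flip: matrix_vector_mul_assoc)
      then have "?P (?T ** A)" using z \<open>u \<in> X\<close> by (intro move1 T_F A X_diff) auto
      then show ?thesis by (rule step)
    qed
  qed
  from this [of A UNIV] assms show ?thesis by simp
qed


lemma Omega_real_mult_vector:
  "(Omega_real *v x) $ (i, b) = (if b then - x $ (i, False) else x $ (i, True))"
proof -
  have "(Omega_real *v x) $ (i, b) = (\<Sum>s\<in>UNIV. Omega_real $ (i, b) $ s * x $ s)"
    by (simp add: matrix_vector_mult_def)
  also have "\<dots> = (\<Sum>s\<in>UNIV. if s = (i, \<not> b) then (if b then - x $ (i, False) else x $ (i, True)) else 0)"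
    by (rule sum.cong) (auto simp: Omega_real_def)
  finally show ?thesis by simp
qed

lemma Omega_real_square: "Omega_real ** Omega_real = - mat 1"
  by (rule matrix_eq [THEN iffD2])
    (auto simp: vec_eq_iff Omega_real_mult_vector matrix_vector_mult_uminus simp flip: matrix_vector_mul_assoc)

text \<open>The determinant is \<open>1\<close> or \<open>- 1\<close>, and connectedness excludes the second value.\<close>

lemma det_symplectic:
  fixes A :: "real ^ ('n::finite \<times> bool) ^ ('n \<times> bool)"
  assumes "A \<in> symplectic"
  shows "det A = 1"
proof -
  have sq: "det B = 1 \<or> det B = - 1" if "B \<in> symplectic" for B :: "real ^ ('n \<times> bool) ^ ('n \<times> bool)"
  proof -
    define J :: "real ^ ('n \<times> bool) ^ ('n \<times> bool)" where "J = Omega_real"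
    have "J ** - J = mat 1" by (simp add: J_def matrix_mul_simps Omega_real_square)
    from arg_cong [OF this, of det] have "det J \<noteq> 0" by (auto simp: det_mul)
    moreover have "det (transpose B ** J ** B) = det J"
      using that by (simp add: symplectic_def J_def)
    then have "det B * det B * det J = 1 * det J" by (simp add: det_mul mult_ac)
    ultimately have "det B * det B = 1" using mult_right_cancel by blast
    then show ?thesis by (simp add: square_eq_1_iff)
  qed
  obtain g where g: "path g" "path_image g \<subseteq> symplectic" "pathstart g = mat 1" "pathfinish g = A"
    using path_component_symplectic [OF assms] by (auto simp: path_component_def)
  have "continuous_on (path_image g) (\<lambda>B. det B)"
    unfolding det_def by (intro continuous_intros)
  then have "connected (det ` path_image g)"
    using connected_continuous_image connected_path_image g(1) by blast
  moreover have "1 \<in> det ` path_image g" using g(3) by (metis det_I image_eqI pathstart_in_path_image)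
  moreover have "det A \<in> det ` path_image g" using g(4) by (metis image_eqI pathfinish_in_path_image)
  moreover have "0 \<notin> det ` path_image g" using sq g(2) by fastforce
  ultimately have "det A \<noteq> - 1" by (metis connectedD_interval neg_le_0_iff_le zero_le_one)
  then show ?thesis using sq [OF assms] by blast
qed

section \<open>Parity and body in the Grassmann algebra\<close>

lemma subspace_gr_even: "subspace gr_even" and subspace_gr_odd: "subspace gr_odd"
  by (simp_all add: gr_even_def gr_odd_def)

lemmas gr_even_closed =
  subspace_0 [OF subspace_gr_even] subspace_add [OF subspace_gr_even] subspace_diff [OF subspace_gr_even]
  subspace_neg [OF subspace_gr_even] subspace_scale [OF subspace_gr_even]

lemmas gr_odd_closed =
  subspace_0 [OF subspace_gr_odd] subspace_add [OF subspace_gr_odd] subspace_diff [OF subspace_gr_odd]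
  subspace_neg [OF subspace_gr_odd] subspace_scale [OF subspace_gr_odd]

lemma one_gr_even: "1 \<in> gr_even"
  by (auto simp: gr_even_iff f_coeffs_one)

lemma gr_odd_times:
  assumes "x \<in> gr_odd" "y \<in> gr_odd"
  shows "x * y \<in> gr_even"
  unfolding gr_even_iff f_coeffs_times
proof (intro allI impI sum.neutral ballI)
  fix C A B :: "'a set"
  assume "odd (card C)"
  then show "(if A \<union> B = C then f_sign A B * (f_coeffs x $ A * f_coeffs y $ B) else 0) = 0"
    using assms by (cases "A \<inter> B = {}") (auto simp: gr_odd_iff f_sign_def card_Un_disjoint)
qed

lemma gr_even_odd_times:
  assumes "x \<in> gr_even" "y \<in> gr_odd"
  shows "x * y \<in> gr_odd"
  unfolding gr_odd_iff f_coeffs_times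
proof (intro allI impI sum.neutral ballI)
  fix C A B :: "'a set"
  assume "even (card C)"
  then show "(if A \<union> B = C then f_sign A B * (f_coeffs x $ A * f_coeffs y $ B) else 0) = 0"
    using assms by (cases "A \<inter> B = {}") (auto simp: gr_odd_iff gr_even_iff f_sign_def card_Un_disjoint)
qed

lemma gr_odd_even_times: "x \<in> gr_odd \<Longrightarrow> y \<in> gr_even \<Longrightarrow> x * y \<in> gr_odd"
  by (metis gr_even_commute gr_even_odd_times)

lemma gr_odd_anticommute:
  assumes x: "x \<in> gr_odd" and y: "y \<in> gr_odd"
  shows "x * y = - (y * x)"
proof (unfold grassmann_eq_iff, rule allI)
  fix C
  have "f_coeffs (x * y) $ C = (\<Sum>A\<in>UNIV. \<Sum>B\<in>UNIV.
      - (if B \<union> A = C then f_sign B A * (f_coeffs y $ B * f_coeffs x $ A) else 0))"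
    unfolding f_coeffs_times
  proof (intro sum.cong refl)
    fix A B :: "'a set"
    show "(if A \<union> B = C then f_sign A B * (f_coeffs x $ A * f_coeffs y $ B) else 0) =
        - (if B \<union> A = C then f_sign B A * (f_coeffs y $ B * f_coeffs x $ A) else 0)"
    proof (cases "odd (card A) \<and> odd (card B)")
      case True
      then show ?thesis by (subst f_sign_commute [of B A]) (auto simp: Un_commute)
    next
      case False
      then show ?thesis using assms by (auto simp: gr_odd_iff)
    qed
  qed
  also have "\<dots> = f_coeffs (- (y * x)) $ C"
    unfolding uminus_grassmann.rep_eq vector_uminus_component f_coeffs_times sum_negf
    by (subst sum.swap) simp
  finally show "f_coeffs (x * y) $ C = f_coeffs (- (y * x)) $ C" .
qed

definition body :: "'k::{finite,linorder} grassmann \<Rightarrow> real" where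
  "body x = f_coeffs x $ {}"

lemma body_linear [simp]:
  "body (x + y) = body x + body y" "body (x - y) = body x - body y" "body (- x) = - body x"
  "body (c *\<^sub>R x) = c * body x" "body 0 = 0" "body 1 = 1"
  by (simp_all add: body_def plus_grassmann.rep_eq minus_grassmann.rep_eq uminus_grassmann.rep_eq
      scaleR_grassmann.rep_eq zero_grassmann.rep_eq f_coeffs_one)

lemma body_times [simp]: "body (x * y) = body x * body y"
proof -
  have "body (x * y) = (\<Sum>A\<in>UNIV. \<Sum>B\<in>UNIV. if B = {} then (if A = {} then f_coeffs x $ A * f_coeffs y $ B else 0) else 0)"
    unfolding body_def f_coeffs_times by (intro sum.cong refl) auto
  then show ?thesis by (simp add: body_def)
qed

lemma body_of_real [simp]: "body (of_real c) = c"
  by (simp add: of_real_def)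

lemma body_sum [simp]: "body (sum g S) = (\<Sum>i\<in>S. body (g i))"
  by (induction S rule: infinite_finite_induct) simp_all

lemma body_odd: "x \<in> gr_odd \<Longrightarrow> body x = 0"
  by (simp add: body_def gr_odd_iff)

text \<open>The powers of the ideal of elements with body zero. They vanish eventually, since there are
  finitely many generators.\<close>

definition degree_ge :: "nat \<Rightarrow> 'k::{finite,linorder} grassmann set" where
  "degree_ge d = {x. \<forall>A. card A < d \<longrightarrow> f_coeffs x $ A = 0}"

lemma degree_ge_sum: "(\<And>i. i \<in> S \<Longrightarrow> g i \<in> degree_ge d) \<Longrightarrow> sum g S \<in> degree_ge d"
  by (induction S rule: infinite_finite_induct)
    (auto simp: degree_ge_def zero_grassmann.rep_eq plus_grassmann.rep_eq)

lemma degree_ge_times: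
  assumes "body x = 0" "y \<in> degree_ge d"
  shows "x * y \<in> degree_ge (Suc d)"
  unfolding degree_ge_def mem_Collect_eq f_coeffs_times
proof (intro allI impI sum.neutral ballI)
  fix C A B :: "'a set"
  assume C: "card C < Suc d"
  show "(if A \<union> B = C then f_sign A B * (f_coeffs x $ A * f_coeffs y $ B) else 0) = 0"
  proof (cases "A \<union> B = C \<and> A \<inter> B = {} \<and> A \<noteq> {}")
    case True
    then have "card C = card A + card B" by (metis card_Un_disjoint finite)
    moreover have "card A \<noteq> 0" using True by (simp add: card_eq_0_iff)
    ultimately have "card B < d" using C by linarith
    then show ?thesis using assms(2) by (simp add: degree_ge_def)
  qed (use assms(1) in \<open>auto simp: f_sign_def body_def\<close>)
qed

lemma degree_ge_all: "(\<And>d. x \<in> degree_ge d) \<Longrightarrow> x = 0"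
  by (simp add: degree_ge_def grassmann_eq_iff zero_grassmann.rep_eq) blast

text \<open>Each application of \<open>x = y * x\<close> puts \<open>x\<close> into the next power of the ideal.\<close>

lemma body_zero_fixed:
  assumes "body y = 0" "x = y * x"
  shows "x = 0"
proof (rule degree_ge_all)
  show "x \<in> degree_ge d" for d
  proof (induction d)
    case 0
    show ?case by (simp add: degree_ge_def)
  next
    case (Suc d)
    then show ?case using degree_ge_times [OF assms(1)] assms(2) by metis
  qed
qed

section \<open>Matrices over the Grassmann algebra\<close>

lemma mat_component: "mat c $ i $ j = (if i = j then c else 0)"
  by (simp add: mat_def)

lemma transpose_component: "transpose A $ i $ j = A $ j $ i"
  by (simp add: transpose_def)

definition even_mat :: "'k::{finite,linorder} grassmann ^ 'n ^ 'm \<Rightarrow> bool" where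
  "even_mat A \<longleftrightarrow> (\<forall>i j. A $ i $ j \<in> gr_even)"

definition odd_mat :: "'k::{finite,linorder} grassmann ^ 'n ^ 'm \<Rightarrow> bool" where
  "odd_mat A \<longleftrightarrow> (\<forall>i j. A $ i $ j \<in> gr_odd)"

definition body_mat :: "'k::{finite,linorder} grassmann ^ 'n ^ 'm \<Rightarrow> real ^ 'n ^ 'm" where
  "body_mat A = (\<chi> i j. body (A $ i $ j))"

lemma body_mat_linear [simp]:
  "body_mat (A + B) = body_mat A + body_mat B" "body_mat (A - B) = body_mat A - body_mat B"
  "body_mat (- A) = - body_mat A" "body_mat (c *\<^sub>R A) = c *\<^sub>R body_mat A" "body_mat 0 = 0"
  "body_mat (mat 1) = mat 1" "body_mat (transpose A) = transpose (body_mat A)"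
  by (simp_all add: body_mat_def vec_eq_iff mat_def transpose_def)

lemma body_mat_mul [simp]: "body_mat (A ** B) = body_mat A ** body_mat B"
  by (simp add: body_mat_def matrix_matrix_mult_def)

lemma body_mat_odd [simp]: "odd_mat A \<Longrightarrow> body_mat A = 0"
  by (simp add: body_mat_def odd_mat_def vec_eq_iff body_odd)

text \<open>If \<open>A\<close> kills \<open>Z\<close>, then \<open>Z = (1 - A) Z\<close>, and the entries of \<open>1 - A\<close> have body zero. So the entries of
  \<open>Z\<close> lie in all powers of the ideal.\<close>

lemma unit_of_body:
  assumes "body_mat A = mat 1"
  shows "matrix_algebra.unit A"
proof (rule matrix_algebra.unitI_injective)
  fix Z assume Z: "A ** Z = 0"
  define N where "N = mat 1 - A"
  have N: "body (N $ i $ j) = 0" for i j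
    using assms by (simp add: N_def body_mat_def vec_eq_iff mat_def)
  have ZN: "Z = N ** Z" by (simp add: N_def matrix_mul_simps Z)
  have "Z $ i $ j \<in> degree_ge d" for i j d
  proof (induction d arbitrary: i j)
    case 0
    show ?case by (simp add: degree_ge_def)
  next
    case (Suc d)
    have "Z $ i $ j = (\<Sum>k\<in>UNIV. N $ i $ k * Z $ k $ j)"
      by (subst ZN) (simp add: matrix_matrix_mult_def)
    also have "\<dots> \<in> degree_ge (Suc d)"
      by (intro degree_ge_sum degree_ge_times N Suc)
    finally show ?case .
  qed
  then have "Z $ i $ j = 0" for i j by (rule degree_ge_all)
  then show "Z = 0" by (simp add: vec_eq_iff)
qed

lemma even_mat_simps [intro]:
  "even_mat A \<Longrightarrow> even_mat B \<Longrightarrow> even_mat (A + B)"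
  "even_mat A \<Longrightarrow> even_mat B \<Longrightarrow> even_mat (A - B)"
  "even_mat A \<Longrightarrow> even_mat (- A)"
  "even_mat A \<Longrightarrow> even_mat (c *\<^sub>R A)"
  "even_mat A \<Longrightarrow> even_mat (transpose A)"
  "even_mat 0" "even_mat (mat 1)"
  by (auto simp: even_mat_def transpose_def mat_def one_gr_even gr_even_closed)

lemma odd_mat_simps [intro]:
  "odd_mat A \<Longrightarrow> odd_mat B \<Longrightarrow> odd_mat (A + B)"
  "odd_mat A \<Longrightarrow> odd_mat B \<Longrightarrow> odd_mat (A - B)"
  "odd_mat A \<Longrightarrow> odd_mat (- A)"
  "odd_mat A \<Longrightarrow> odd_mat (c *\<^sub>R A)"
  "odd_mat A \<Longrightarrow> odd_mat (transpose A)" "odd_mat 0"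
  by (auto simp: odd_mat_def transpose_def gr_odd_closed)

lemma parity_mul [intro]:
  "even_mat A \<Longrightarrow> even_mat B \<Longrightarrow> even_mat (A ** B)"
  "odd_mat A \<Longrightarrow> odd_mat B \<Longrightarrow> even_mat (A ** B)"
  "even_mat A \<Longrightarrow> odd_mat B \<Longrightarrow> odd_mat (A ** B)"
  "odd_mat A \<Longrightarrow> even_mat B \<Longrightarrow> odd_mat (A ** B)"
  unfolding even_mat_def odd_mat_def matrix_matrix_mult_def
  by (simp_all add: subspace_sum [OF subspace_gr_even] subspace_sum [OF subspace_gr_odd]
      gr_even_times gr_odd_times gr_even_odd_times gr_odd_even_times)

lemma even_mat_inverse:
  assumes "even_mat A" "matrix_algebra.unit A"
  shows "even_mat (matrix_algebra.inverse_of A)"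
proof -
  have "subspace (Collect even_mat)" by (auto simp: subspace_def)
  then have "matrix_algebra.inverse_of A \<in> Collect even_mat"
    by (rule matrix_algebra.inverse_of_in_subalgebra) (use assms in auto)
  then show ?thesis by simp
qed

lemma matrix_inv_eq_inverse_of: "matrix_inv A = matrix_algebra.inverse_of A"
  by (simp add: matrix_inv_def matrix_algebra.inverse_of_def)


section \<open>Determinants of even matrices\<close>

lemma of_even_simps [simp]:
  "of_even 0 = 0" "of_even 1 = 1" "of_even (x + y) = of_even x + of_even y"
  "of_even (x * y) = of_even x * of_even y" "of_even (- x) = - of_even x"
  by (simp_all add: zero_even_grassmann.rep_eq one_even_grassmann.rep_eq plus_even_grassmann.rep_eq
      times_even_grassmann.rep_eq uminus_even_grassmann.rep_eq)

lemma of_even_sum [simp]: "of_even (sum g S) = (\<Sum>i\<in>S. of_even (g i))"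
  by (induction S rule: infinite_finite_induct) simp_all

lemma of_even_Even [simp]: "x \<in> gr_even \<Longrightarrow> of_even (Even x) = x"
  by (rule Even_inverse)

lemma even_det_in_gr_even: "even_det A \<in> gr_even"
  by (simp add: even_det_def of_even)

lemma even_det_commute: "even_det A * x = x * even_det A"
  by (rule gr_even_commute [OF even_det_in_gr_even])

lemma even_det_1 [simp]: "even_det (mat 1) = 1"
proof -
  have "(\<chi> i j. Even (mat 1 $ i $ j)) = (mat 1 :: 'a even_grassmann ^ 'b ^ 'b)"
    by (simp add: vec_eq_iff mat_def flip: of_even_inject) (simp add: one_gr_even subspace_0 [OF subspace_gr_even])
  then show ?thesis by (simp add: even_det_def)
qed

lemma even_det_mul:
  assumes "even_mat A" "even_mat B"
  shows "even_det (A ** B) = even_det A * even_det B"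
proof -
  have AB: "A $ i $ j \<in> gr_even" "B $ i $ j \<in> gr_even" for i j
    using assms by (auto simp: even_mat_def)
  have "of_even (Even (\<Sum>k\<in>UNIV. A $ i $ k * B $ k $ j))
      = of_even (\<Sum>k\<in>UNIV. Even (A $ i $ k) * Even (B $ k $ j))" for i j
    by (subst of_even_Even) (auto intro!: subspace_sum [OF subspace_gr_even] gr_even_times simp: AB)
  then have "(\<chi> i j. Even ((A ** B) $ i $ j)) = (\<chi> i j. Even (A $ i $ j)) ** (\<chi> i j. Even (B $ i $ j))"
    unfolding of_even_inject by (simp add: vec_eq_iff matrix_matrix_mult_def)
  then show ?thesis by (simp add: even_det_def det_mul)
qed

lemma even_det_transpose: "even_det (transpose A) = even_det A"
  unfolding even_det_def
  by (subst det_transpose [symmetric]) (simp add: transpose_def)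

lemma body_even_det:
  assumes "even_mat A"
  shows "body (even_det A) = det (body_mat A)"
proof -
  let ?b = "\<lambda>x. body (of_even x)"
  have prod: "?b (prod g S) = (\<Prod>i\<in>S. ?b (g i))" for g :: "'b \<Rightarrow> 'a even_grassmann" and S
    by (induction S rule: infinite_finite_induct) simp_all
  have sum: "?b (sum g S) = (\<Sum>i\<in>S. ?b (g i))" for g :: "('b \<Rightarrow> 'b) \<Rightarrow> 'a even_grassmann" and S
    by simp
  have sign: "?b (of_int (sign p)) = of_int (sign p)" for p :: "'b \<Rightarrow> 'b"
    by (simp add: sign_def)
  have "A $ i $ j \<in> gr_even" for i j using assms by (simp add: even_mat_def)
  then show ?thesis
    unfolding even_det_def det_def sum by (simp add: prod sign body_mat_def)
qed

text \<open>Only the identity contributes to the Leibniz formula: every other permutation moves some point to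
  a place different from \<open>b\<close>.\<close>

lemma det_one_column:
  fixes A :: "'a::comm_ring_1 ^ 'n ^ 'n"
  assumes "\<And>i j. j \<noteq> b \<Longrightarrow> A $ i $ j = (if i = j then 1 else 0)"
  shows "det A = A $ b $ b"
proof -
  let ?t = "\<lambda>p. of_int (sign p) * (\<Prod>i\<in>UNIV. A $ i $ p i)"
  have "?t p = (if p = id then A $ b $ b else 0)" if p: "p permutes UNIV" for p
  proof (cases "p = id")
    case True
    have "(\<Prod>i\<in>UNIV. A $ i $ i) = (\<Prod>i\<in>UNIV. if i = b then A $ b $ b else 1)"
      by (rule prod.cong) (auto simp: assms)
    then show ?thesis by (simp add: True)
  next
    case False
    then obtain i where i: "p i \<noteq> i" by (auto simp: fun_eq_iff)
    have inj: "inj p" using p permutes_inj by blast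
    obtain k where "p k \<noteq> k" "p k \<noteq> b"
    proof (cases "p i = b")
      case True
      then have "p (p i) \<noteq> p i" using i inj by (metis injD)
      then show ?thesis using True that by metis
    qed (use i that in blast)
    then have "A $ k $ p k = 0" by (simp add: assms)
    then have "(\<Prod>i\<in>UNIV. A $ i $ p i) = 0" by (metis UNIV_I finite prod_zero)
    then show ?thesis by (simp add: False)
  qed
  note Leibniz_term = this
  have "det A = (\<Sum>p\<in>{p :: 'n \<Rightarrow> 'n. p permutes UNIV}. if p = id then A $ b $ b else 0)"
    unfolding det_def by (rule sum.cong) (simp_all add: Leibniz_term)
  then show ?thesis by (simp add: permutes_id)
qed

lemma even_det_one_column:
  assumes "even_mat A" "\<And>i j. j \<noteq> b \<Longrightarrow> A $ i $ j = (if i = j then 1 else 0)"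
  shows "even_det A = A $ b $ b"
proof -
  have "Even (0::'a grassmann) = 0" "Even (1::'a grassmann) = 1"
    by (simp_all add: one_gr_even subspace_0 [OF subspace_gr_even] flip: of_even_inject)
  then have "even_det A = of_even (Even (A $ b $ b))"
    unfolding even_det_def by (subst det_one_column [of b]) (auto simp: assms(2))
  then show ?thesis using assms(1) by (simp add: even_mat_def)
qed


text \<open>If \<open>r\<close> is the only entry of \<open>R\<close> and \<open>p\<close> the corresponding entry of \<open>P\<close>, the two determinants are
  \<open>1 - p r\<close> and \<open>1 - r p = 1 + p r\<close>, and odd elements have square zero.\<close>

lemma even_det_odd_single_entry:
  fixes P :: "'k::{finite,linorder} grassmann ^ 'j ^ 'i" and R :: "'k grassmann ^ 'i ^ 'j"
  assumes P: "odd_mat P" and R: "odd_mat R" and single: "\<And>j i. (j, i) \<noteq> (a, b) \<Longrightarrow> R $ j $ i = 0"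
  shows "even_det (mat 1 - P ** R) * even_det (mat 1 - R ** P) = 1"
proof -
  define r where "r = R $ a $ b"
  define p where "p = P $ b $ a"
  have "(P ** R) $ i $ i' = (\<Sum>k\<in>UNIV. if k = a then (if i' = b then P $ i $ a * r else 0) else 0)" for i i'
    unfolding matrix_matrix_mult_def by (simp only: vec_lambda_beta, rule sum.cong) (auto simp: r_def single)
  then have PR: "(P ** R) $ i $ i' = (if i' = b then P $ i $ a * r else 0)" for i i' by simp
  have "(R ** P) $ j $ j' = (\<Sum>k\<in>UNIV. if k = b then (if j = a then r * P $ b $ j' else 0) else 0)" for j j'
    unfolding matrix_matrix_mult_def by (simp only: vec_lambda_beta, rule sum.cong) (auto simp: r_def single)
  then have RP: "(R ** P) $ j $ j' = (if j = a then r * P $ b $ j' else 0)" for j j' by simp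
  have "even_det (mat 1 - P ** R) = 1 - p * r"
    using parity_mul(2) [OF P R] by (subst even_det_one_column [of _ b]) (auto simp: PR p_def mat_component)
  moreover have "even_det (transpose (mat 1 - R ** P)) = 1 - r * p"
    using parity_mul(2) [OF R P]
    by (subst even_det_one_column [of _ a]) (auto simp: RP p_def mat_component transpose_component)
  moreover have rp: "r * p = - (p * r)"
    using P R by (intro gr_odd_anticommute) (auto simp: odd_mat_def p_def r_def)
  moreover have "r * r = - (r * r)"
    using R by (intro gr_odd_anticommute) (auto simp: odd_mat_def r_def)
  then have "2 *\<^sub>R (r * r) = 0" by (simp only: scaleR_2 add_eq_0_iff)
  then have "r * r = 0" by simp
  then have "(p * r) * (r * p) = 0" by (simp add: mult.assoc [of p] mult.assoc [symmetric, of r r])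
  then have "(p * r) * (p * r) = 0" by (simp add: rp)
  moreover have "(1 - p * r) * (1 + p * r) = 1 - (p * r) * (p * r)"
    by (simp add: algebra_simps)
  ultimately show ?thesis by (simp only: even_det_transpose) simp
qed

text \<open>This is the multiplicative form of the identity \<open>tr (P R) = - tr (R P)\<close> for odd matrices.
  The matrix \<open>R\<close> is built up one entry at a time: adding \<open>R'\<close> to \<open>R\<close> multiplies the product of
  determinants by the same product for \<open>R'\<close> and \<open>(1 - P R)\<^sup>-\<^sup>1 P\<close>.\<close>

lemma even_det_odd_swap:
  fixes P :: "'k::{finite,linorder} grassmann ^ 'j ^ 'i" and R :: "'k grassmann ^ 'i ^ 'j"
  assumes P: "odd_mat P" and R: "odd_mat R"
  shows "even_det (mat 1 - P ** R) * even_det (mat 1 - R ** P) = 1"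
proof -
  have "even_det (mat 1 - P ** R) * even_det (mat 1 - R ** P) = 1"
    if "odd_mat R" "\<And>j i. (j, i) \<notin> F \<Longrightarrow> R $ j $ i = 0" for F and R :: "'k grassmann ^ 'i ^ 'j"
    using finite [of F] that
  proof (induction F arbitrary: R rule: finite_induct)
    case empty
    then have "R = 0" by (simp add: vec_eq_iff)
    then show ?case by (simp add: matrix_mul_simps)
  next
    case (insert ab F)
    obtain a b where ab: "ab = (a, b)" by force
    define R1 where "R1 = (\<chi> j i. if (j, i) = (a, b) then 0 else R $ j $ i)"
    define R2 where "R2 = (\<chi> j i. if (j, i) = (a, b) then R $ j $ i else 0)"
    have R12: "R = R1 + R2" by (simp add: R1_def R2_def vec_eq_iff)
    have odd: "odd_mat R1" "odd_mat R2"
      using insert.prems(1) by (auto simp: odd_mat_def R1_def R2_def gr_odd_closed)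
    define X where "X = mat 1 - P ** R1"
    define Y where "Y = mat 1 - R1 ** P"
    have even: "even_mat X" "even_mat Y" unfolding X_def Y_def using P odd by blast+
    have "body_mat X = mat 1" by (simp add: X_def P matrix_mul_simps)
    then have X: "matrix_algebra.unit X" by (rule unit_of_body)
    define P' where "P' = matrix_algebra.inverse_of X ** P"
    have P': "odd_mat P'" unfolding P'_def using even_mat_inverse [OF even(1) X] P by blast
    have XP': "X ** P' = P" by (simp add: P'_def matrix_mul_assoc matrix_algebra.inverse_of X)
    have XP: "X ** P = P ** Y" by (simp add: X_def Y_def matrix_mul_simps matrix_mul_assoc)
    have P'Y: "P' ** Y = P"
      by (simp only: P'_def matrix_mul_assoc [symmetric, of _ P Y] XP [symmetric])
        (simp add: matrix_mul_assoc matrix_algebra.inverse_of X)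
    have "mat 1 - P ** R = X - X ** P' ** R2" by (simp add: XP') (simp add: X_def R12 matrix_mul_simps)
    also have "\<dots> = X ** (mat 1 - P' ** R2)" by (simp add: matrix_mul_simps matrix_mul_assoc)
    finally have 1: "even_det (mat 1 - P ** R) = even_det X * even_det (mat 1 - P' ** R2)"
      using even P' odd by (simp add: even_det_mul even_mat_simps parity_mul)
    have "mat 1 - R ** P = Y - R2 ** (P' ** Y)" by (simp add: P'Y) (simp add: Y_def R12 matrix_mul_simps)
    also have "\<dots> = (mat 1 - R2 ** P') ** Y" by (simp add: matrix_mul_simps matrix_mul_assoc)
    finally have 2: "even_det (mat 1 - R ** P) = even_det (mat 1 - R2 ** P') * even_det Y"
      using even P' odd by (simp add: even_det_mul even_mat_simps parity_mul)
    have "even_det (mat 1 - P' ** R2) * even_det (mat 1 - R2 ** P') = 1"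
      by (rule even_det_odd_single_entry [OF P' odd(2), of a b]) (auto simp: R2_def)
    moreover have "even_det X * even_det Y = 1"
      unfolding X_def Y_def
      by (rule insert.IH [OF odd(1)]) (use insert.prems(2) in \<open>auto simp: R1_def ab\<close>)
    moreover have "even_det X * even_det (mat 1 - P' ** R2) * (even_det (mat 1 - R2 ** P') * even_det Y)
        = even_det X * (even_det (mat 1 - P' ** R2) * even_det (mat 1 - R2 ** P')) * even_det Y"
      by (simp only: mult.assoc)
    ultimately show ?case unfolding 1 2 by simp
  qed
  from this [of R UNIV] R show ?thesis by simp
qed

section \<open>Supermatrices\<close>

lemma sum_plus_UNIV: "(\<Sum>r\<in>UNIV. g r) = (\<Sum>i\<in>UNIV. g (Inl i)) + (\<Sum>j\<in>UNIV. g (Inr j))"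
  for g :: "'a::finite + 'b::finite \<Rightarrow> 'c::comm_monoid_add"
  by (simp add: sum.Plus flip: UNIV_Plus_UNIV)

lemmas block_defs = blockA_def blockB_def blockC_def blockD_def

lemma block_mul:
  "blockA (M ** N) = blockA M ** blockA N + blockB M ** blockC N"
  "blockB (M ** N) = blockA M ** blockB N + blockB M ** blockD N"
  "blockC (M ** N) = blockC M ** blockA N + blockD M ** blockC N"
  "blockD (M ** N) = blockC M ** blockB N + blockD M ** blockD N"
  by (simp_all add: block_defs matrix_matrix_mult_def vec_eq_iff sum_plus_UNIV)

lemma block_add:
  "blockA (M + N) = blockA M + blockA N" "blockB (M + N) = blockB M + blockB N"
  "blockC (M + N) = blockC M + blockC N" "blockD (M + N) = blockD M + blockD N"
  by (simp_all add: block_defs vec_eq_iff)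

lemma block_scaleR:
  "blockA (c *\<^sub>R M) = c *\<^sub>R blockA M" "blockB (c *\<^sub>R M) = c *\<^sub>R blockB M"
  "blockC (c *\<^sub>R M) = c *\<^sub>R blockC M" "blockD (c *\<^sub>R M) = c *\<^sub>R blockD M"
  by (simp_all add: block_defs vec_eq_iff)

lemma block_one:
  "blockA (mat 1) = mat 1" "blockB (mat 1) = 0" "blockC (mat 1) = 0" "blockD (mat 1) = mat 1"
  by (simp_all add: block_defs vec_eq_iff mat_def)

lemma block_block_matrix [simp]:
  "blockA (block_matrix A B C D) = A" "blockB (block_matrix A B C D) = B"
  "blockC (block_matrix A B C D) = C" "blockD (block_matrix A B C D) = D"
  by (simp_all add: block_defs block_matrix_def vec_eq_iff)

lemma block_eqI:
  assumes "blockA M = blockA N" "blockB M = blockB N" "blockC M = blockC N" "blockD M = blockD N"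
  shows "M = N"
proof -
  have "M $ r $ s = N $ r $ s" for r s
    using assms by (cases r; cases s) (simp_all add: block_defs vec_eq_iff del: split_paired_All)
  then show ?thesis by (simp add: vec_eq_iff)
qed

lemma Mat_iff: "M \<in> Mat \<longleftrightarrow> even_mat (blockA M) \<and> odd_mat (blockB M) \<and> odd_mat (blockC M) \<and> even_mat (blockD M)"
  by (auto simp: Mat_def even_mat_def odd_mat_def)

lemma subspace_Mat: "subspace (Mat :: (('m::finite, 'n::finite, 'k::{finite,linorder}) supermatrix) set)"
  unfolding subspace_def by (auto simp: Mat_iff block_add block_scaleR) (auto simp: even_mat_def odd_mat_def block_defs gr_even_closed gr_odd_closed)

lemma Mat_mul: "M \<in> Mat \<Longrightarrow> N \<in> Mat \<Longrightarrow> M ** N \<in> Mat"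
  by (auto simp: Mat_iff block_mul)

lemma one_in_Mat: "mat 1 \<in> Mat"
  by (auto simp: Mat_iff block_one)

lemma body_mat_blockA_mul:
  "M \<in> Mat \<Longrightarrow> body_mat (blockA (M ** N)) = body_mat (blockA M) ** body_mat (blockA N)"
  by (simp add: block_mul Mat_iff matrix_mul_simps)

lemma body_mat_eqI:
  assumes "M \<in> Mat" "N \<in> Mat" "body_mat (blockA M) = body_mat (blockA N)"
    "body_mat (blockD M) = body_mat (blockD N)"
  shows "body_mat M = body_mat N"
proof -
  have "body_mat M $ r $ s = body_mat N $ r $ s" for r s
    using assms by (cases r; cases s) (simp_all add: Mat_def block_defs body_mat_def vec_eq_iff body_odd del: split_paired_All)
  then show ?thesis by (simp add: vec_eq_iff)
qed

lemma transpose_mul_even: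
  assumes "even_mat A \<or> even_mat B"
  shows "transpose (A ** B) = transpose B ** transpose A"
proof -
  have "A $ i $ k * B $ k $ j = B $ k $ j * A $ i $ k" for i j k
    using assms gr_even_commute by (metis even_mat_def)
  then show ?thesis by (simp add: transpose_def matrix_matrix_mult_def vec_eq_iff)
qed

lemma transpose_mul_odd:
  assumes "odd_mat A" "odd_mat B"
  shows "transpose (A ** B) = - (transpose B ** transpose A)"
proof -
  have "A $ i $ k * B $ k $ j = - (B $ k $ j * A $ i $ k)" for i j k
    using assms by (intro gr_odd_anticommute) (auto simp: odd_mat_def)
  then show ?thesis by (simp add: transpose_def matrix_matrix_mult_def vec_eq_iff sum_negf)
qed

lemma transpose_linear:
  "transpose (A + B) = transpose A + transpose B" "transpose (c *\<^sub>R A) = c *\<^sub>R transpose A"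
  "transpose 0 = 0"
  by (simp_all add: transpose_def vec_eq_iff)

text \<open>The sign in the definition of the supertranspose is the one that arises when two odd factors
  are interchanged.\<close>

lemma supertranspose_mul:
  assumes "M \<in> Mat" "N \<in> Mat"
  shows "supertranspose (M ** N) = supertranspose N ** supertranspose M"
  using assms
  by (intro block_eqI)
    (simp_all add: supertranspose_def block_mul Mat_iff transpose_linear transpose_mul_even transpose_mul_odd
      matrix_mul_simps)

lemma linear_supertranspose: "linear supertranspose"
  by (rule linearI)
    (auto intro!: block_eqI simp: supertranspose_def block_add block_scaleR transpose_linear)

lemma supertranspose_one: "supertranspose (mat 1) = mat 1"
  by (rule block_eqI) (simp_all add: supertranspose_def block_one transpose_linear)

lemma supertranspose_Mat: "M \<in> Mat \<Longrightarrow> supertranspose M \<in> Mat"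
  for M :: "('m::finite, 'n::finite, 'k::{finite,linorder}) supermatrix"
  by (auto simp: Mat_iff supertranspose_def)

definition real_mat :: "real ^ 'n ^ 'm \<Rightarrow> 'k::{finite,linorder} grassmann ^ 'n ^ 'm" where
  "real_mat A = (\<chi> i j. of_real (A $ i $ j))"

lemma real_mat_simps:
  "real_mat (A + B) = real_mat A + real_mat B" "real_mat (- A) = - real_mat A"
  "real_mat (c *\<^sub>R A) = c *\<^sub>R real_mat A"
  "real_mat 0 = 0" "real_mat (mat 1) = mat 1" "real_mat (transpose A) = transpose (real_mat A)"
  by (simp_all add: real_mat_def vec_eq_iff mat_def transpose_def) (simp add: of_real_def)

lemma real_mat_mul: "real_mat (A ** B) = real_mat A ** real_mat B"
  by (simp add: real_mat_def vec_eq_iff matrix_matrix_mult_def)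

lemma body_real_mat [simp]: "body_mat (real_mat A) = A"
  by (simp add: real_mat_def body_mat_def)

lemma even_real_mat: "even_mat (real_mat A)"
  by (simp add: even_mat_def real_mat_def of_real_def gr_even_closed one_gr_even)

lemma Omega_eq: "Omega = real_mat Omega_real"
  by (simp add: Omega_def Omega_real_def real_mat_def vec_eq_iff)

lemma Omega_square: "Omega ** Omega = - mat 1"
  by (simp add: Omega_eq Omega_real_square real_mat_simps flip: real_mat_mul)

definition Q_inverse :: "('m::finite, 'n::finite, 'k::{finite,linorder}) supermatrix" where
  "Q_inverse = block_matrix (mat 1) 0 0 (2 *\<^sub>R Omega)"

lemma Q_inverse: "Q_inverse ** Q_form = mat 1" "Q_form ** Q_inverse = mat 1"
proof -
  show "Q_inverse ** Q_form = mat 1"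
    by (rule block_eqI) (simp_all add: Q_inverse_def Q_form_def block_mul matrix_mul_simps Omega_square block_one)
  then show "Q_form ** Q_inverse = mat 1" by (rule matrix_algebra.unitI_left)
qed

lemma Q_Mat: "Q_form \<in> Mat" "Q_inverse \<in> Mat"
  by (auto simp: Mat_iff Q_form_def Q_inverse_def Omega_eq intro: even_real_mat)

definition star :: "('m::finite, 'n::finite, 'k::{finite,linorder}) supermatrix \<Rightarrow> ('m, 'n, 'k) supermatrix" where
  "star M = Q_inverse ** supertranspose M ** Q_form"

lemma star_Mat: "M \<in> Mat \<Longrightarrow> star M \<in> Mat"
  unfolding star_def by (intro Mat_mul Q_Mat supertranspose_Mat)

lemma linear_star: "linear star"
proof -
  have "star = (\<lambda>M. M ** Q_form) \<circ> (**) Q_inverse \<circ> supertranspose"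
    by (simp add: star_def fun_eq_iff)
  moreover have "linear (\<lambda>M. M ** Q_form)"
    using bounded_bilinear.bounded_linear_left [OF matrix_mul_bilinear] bounded_linear.linear by blast
  ultimately show ?thesis
    by (metis linear_compose linear_supertranspose matrix_algebra.linear_mul_left)
qed

lemma star_one: "star (mat 1) = mat 1"
  by (simp add: star_def supertranspose_one Q_inverse)

lemma star_mul:
  assumes "M \<in> Mat" "N \<in> Mat"
  shows "star (M ** N) = star N ** star M"
proof -
  have "star N ** star M = Q_inverse ** supertranspose N ** (Q_form ** Q_inverse) ** supertranspose M ** Q_form"
    by (simp only: star_def matrix_mul_assoc)
  then show ?thesis
    by (simp add: Q_inverse star_def supertranspose_mul assms matrix_mul_assoc)
qed

lemma O\<^sub>0_iff: "M \<in> O\<^sub>0 \<longleftrightarrow> M \<in> Mat \<and> star M ** M = mat 1"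
proof -
  have "supertranspose M ** Q_form ** M = Q_form \<longleftrightarrow> star M ** M = mat 1"
  proof
    assume "supertranspose M ** Q_form ** M = Q_form"
    then have "Q_inverse ** (supertranspose M ** Q_form ** M) = mat 1" by (simp add: Q_inverse)
    then show "star M ** M = mat 1" by (simp add: star_def matrix_mul_assoc)
  next
    assume "star M ** M = mat 1"
    then have "Q_form ** (star M ** M) = Q_form" by simp
    moreover have "Q_form ** (star M ** M) = (Q_form ** Q_inverse) ** supertranspose M ** Q_form ** M"
      by (simp only: star_def matrix_mul_assoc)
    ultimately show "supertranspose M ** Q_form ** M = Q_form" by (simp add: Q_inverse)
  qed
  then show ?thesis by (simp add: O\<^sub>0_def)
qed

lemma O\<^sub>0_blocks:
  assumes "M \<in> O\<^sub>0"
  defines "J \<equiv> (- 1/2) *\<^sub>R Omega"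
  shows "transpose (blockA M) ** blockA M + transpose (blockC M) ** J ** blockC M = mat 1"
    and "transpose (blockA M) ** blockB M + transpose (blockC M) ** J ** blockD M = 0"
    and "transpose (blockD M) ** J ** blockC M = transpose (blockB M) ** blockA M"
    and "transpose (blockD M) ** J ** blockD M - transpose (blockB M) ** blockB M = J"
proof -
  have "supertranspose M ** Q_form ** M = Q_form" using assms(1) by (simp add: O\<^sub>0_def)
  note eqs = this [THEN arg_cong [of _ _ blockA]] this [THEN arg_cong [of _ _ blockB]]
    this [THEN arg_cong [of _ _ blockC]] this [THEN arg_cong [of _ _ blockD]]
  note b = eqs [unfolded block_mul supertranspose_def Q_form_def block_block_matrix J_def [symmetric]]
  show "transpose (blockA M) ** blockA M + transpose (blockC M) ** J ** blockC M = mat 1"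
    using b(1) by (simp add: matrix_mul_simps)
  show "transpose (blockA M) ** blockB M + transpose (blockC M) ** J ** blockD M = 0"
    using b(2) by (simp add: matrix_mul_simps)
  show "transpose (blockD M) ** J ** blockC M = transpose (blockB M) ** blockA M"
    using b(3) by (simp add: matrix_mul_simps)
  show "transpose (blockD M) ** J ** blockD M - transpose (blockB M) ** blockB M = J"
    using b(4) by (simp add: matrix_mul_simps)
qed

lemma O\<^sub>0_body:
  assumes "M \<in> O\<^sub>0"
  shows "transpose (body_mat (blockA M)) ** body_mat (blockA M) = mat 1"
    and "body_mat (blockD M) \<in> symplectic"
proof -
  have M: "odd_mat (blockB M)" "odd_mat (blockC M)" using assms by (auto simp: O\<^sub>0_def Mat_iff)
  show "transpose (body_mat (blockA M)) ** body_mat (blockA M) = mat 1"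
    using arg_cong [OF O\<^sub>0_blocks(1) [OF assms], of body_mat] M by (simp add: matrix_mul_simps)
  have "(- 1/2) *\<^sub>R (transpose (body_mat (blockD M)) ** Omega_real ** body_mat (blockD M)) = (- 1/2) *\<^sub>R Omega_real"
    using arg_cong [OF O\<^sub>0_blocks(4) [OF assms], of body_mat] M by (simp add: matrix_mul_simps Omega_eq)
  then show "body_mat (blockD M) \<in> symplectic" by (simp add: symplectic_def)
qed

lemma gr_even_left_commute: "x \<in> gr_even \<Longrightarrow> x * (y * z) = y * (x * z)"
  by (metis gr_even_commute mult.assoc)

lemmas even_det_ac = mult.assoc gr_even_commute gr_even_left_commute even_det_in_gr_even

text \<open>The Schur complement \<open>A - B D\<^sup>-\<^sup>1 C\<close> is the inverse transpose of \<open>A\<close>, so the superdeterminant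
  is the inverse of \<open>\<delta> = det A det D\<close>. With \<open>P = C\<^sup>T\<close> and \<open>R = J C\<close> one finds \<open>A\<^sup>T A = 1 - P R\<close> and
  \<open>J = D\<^sup>T (1 - R P)\<^sup>-\<^sup>1 J D\<close>, hence \<open>\<delta>\<^sup>2 = det (1 - P R) det (1 - R P) = 1\<close>. The body of \<open>\<delta>\<close> is that of
  \<open>det A\<close>, since symplectic matrices have determinant \<open>1\<close>, and it determines \<open>\<delta>\<close>.\<close>

lemma sdet_eq_1_iff:
  fixes M :: "('m::finite, 'n::finite, 'k::{finite,linorder}) supermatrix"
  assumes M: "M \<in> O\<^sub>0"
  shows "sdet M = 1 \<longleftrightarrow> det (body_mat (blockA M)) = 1"
proof -
  define A B C D where "A = blockA M" and "B = blockB M" and "C = blockC M" and "D = blockD M"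
  define J :: "'k grassmann ^ ('n \<times> bool) ^ ('n \<times> bool)" where "J = (- 1/2) *\<^sub>R Omega"
  have parity [simp]: "even_mat A" "odd_mat B" "odd_mat C" "even_mat D"
    using M by (auto simp: O\<^sub>0_def Mat_iff A_def B_def C_def D_def)
  have J_even [simp]: "even_mat J" by (auto simp: J_def Omega_eq intro: even_real_mat)
  have JJ: "(2 *\<^sub>R Omega) ** J = mat 1" by (simp add: J_def matrix_mul_simps Omega_square)
  note eqs = O\<^sub>0_blocks [OF M, folded A_def B_def C_def D_def J_def]
  define P R where "P = transpose C" and "R = J ** C"
  have PR [simp]: "odd_mat P" "odd_mat R" by (auto simp: P_def R_def)
  have AtA: "transpose A ** A = mat 1 - P ** R"
    using eqs(1) by (simp add: P_def R_def matrix_mul_assoc eq_diff_eq)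
  define Z where "Z = matrix_algebra.inverse_of (mat 1 - P ** R)"
  have unit_PR: "matrix_algebra.unit (mat 1 - P ** R)"
    by (rule unit_of_body) (simp add: matrix_mul_simps)
  then have Z: "(mat 1 - P ** R) ** Z = mat 1" "Z ** (mat 1 - P ** R) = mat 1"
    by (simp_all add: Z_def matrix_algebra.inverse_of)
  have unit_D: "matrix_algebra.unit D"
  proof -
    have "body_mat ((2 *\<^sub>R Omega) ** (transpose D ** J ** D)) = body_mat ((2 *\<^sub>R Omega) ** J)"
      using arg_cong [OF eqs(4), of body_mat] by (simp add: matrix_mul_simps)
    then have "matrix_algebra.unit ((2 *\<^sub>R Omega) ** (transpose D ** J ** D))"
      by (intro unit_of_body) (simp add: JJ)
    then obtain Y where "Y ** ((2 *\<^sub>R Omega) ** (transpose D ** J ** D)) = mat 1"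
      by (auto simp: matrix_algebra.unit_def)
    then have "(Y ** ((2 *\<^sub>R Omega) ** (transpose D ** J))) ** D = mat 1" by (simp add: matrix_mul_assoc)
    then show ?thesis by (rule matrix_algebra.unitI_left)
  qed
  define D' where "D' = matrix_inv D"
  have D': "D ** D' = mat 1" "D' ** D = mat 1"
    by (simp_all add: D'_def matrix_inv_eq_inverse_of matrix_algebra.inverse_of unit_D)
  have D'_even [simp]: "even_mat D'"
    using even_mat_inverse [OF parity(4) unit_D] by (simp add: D'_def matrix_inv_eq_inverse_of)
  define S where "S = A - B ** D' ** C"
  have S_even [simp]: "even_mat S" unfolding S_def by (intro even_mat_simps parity_mul parity D'_even)
  have AtB: "transpose A ** B = - (transpose C ** J ** D)"
    using eqs(2) by (simp add: eq_neg_iff_add_eq_0)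
  have "transpose A ** S = transpose A ** A - (transpose A ** B) ** D' ** C"
    by (simp add: S_def matrix_mul_simps matrix_mul_assoc)
  also have "\<dots> = transpose A ** A + transpose C ** J ** (D ** D') ** C"
    unfolding AtB by (simp add: matrix_mul_simps matrix_mul_assoc)
  also have "\<dots> = mat 1" using eqs(1) by (simp add: D')
  finally have AS: "even_det A * even_det S = 1"
    using even_det_mul [of "transpose A" S] by (simp add: even_mat_simps even_det_transpose)
  have DD': "even_det D * even_det D' = 1"
    using even_det_mul [of D D'] by (simp add: D')
  have "gr_inverse (even_det D) = even_det D'"
    unfolding gr_inverse_def
  proof (rule the_equality)
    show "even_det D * even_det D' = 1 \<and> even_det D' * even_det D = 1"
      using DD' even_det_commute [of D "even_det D'"] by simp
    show "y = even_det D'" if "even_det D * y = 1 \<and> y * even_det D = 1" for y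
    proof -
      have "y * (even_det D * even_det D') = (y * even_det D) * even_det D'" by (simp only: mult.assoc)
      then show ?thesis using that DD' by simp
    qed
  qed
  then have sdet: "sdet M = even_det S * even_det D'"
    by (simp add: sdet_def S_def D'_def A_def B_def C_def D_def)
  define \<delta> where "\<delta> = even_det A * even_det D"
  have "sdet M * \<delta> = (even_det A * even_det S) * (even_det D * even_det D')"
    by (simp only: sdet \<delta>_def even_det_ac)
  then have sdet_\<delta>: "sdet M * \<delta> = 1" by (simp add: AS DD')
  then have "sdet M = 1 \<Longrightarrow> \<delta> = 1" "\<delta> = 1 \<Longrightarrow> sdet M = 1" by simp_all
  then have sdet_iff: "sdet M = 1 \<longleftrightarrow> \<delta> = 1" by blast
  have "even_det A * even_det A = even_det (mat 1 - P ** R)"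
    using even_det_mul [of "transpose A" A] by (simp add: AtA even_mat_simps even_det_transpose)
  moreover have "even_det D * even_det D = even_det (mat 1 - R ** P)"
  proof -
    \<comment> \<open>\<open>K\<close> is the inverse of \<open>1 - R P\<close>.\<close>
    define K where "K = mat 1 + R ** Z ** P"
    have Z_even: "even_mat Z"
      unfolding Z_def by (intro even_mat_inverse unit_PR even_mat_simps parity_mul PR)
    then have K_even [simp]: "even_mat K" unfolding K_def by (intro even_mat_simps parity_mul PR)
    have "(mat 1 - R ** P) ** K = mat 1 - R ** P + R ** ((mat 1 - P ** R) ** Z) ** P"
      by (simp add: K_def matrix_mul_simps matrix_mul_assoc)
    then have K: "(mat 1 - R ** P) ** K = mat 1" by (simp add: Z)
    have "(Z ** transpose A) ** A = mat 1" by (simp add: AtA Z flip: matrix_mul_assoc)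
    then have "A ** (Z ** transpose A) = mat 1" by (rule matrix_algebra.unitI_left)
    then have "transpose B ** B = transpose B ** (A ** (Z ** transpose A)) ** B" by simp
    also have "\<dots> = (transpose B ** A) ** Z ** (transpose A ** B)" by (simp only: matrix_mul_assoc)
    also have "\<dots> = - (transpose D ** J ** C ** Z ** transpose C ** J ** D)"
      unfolding AtB eqs(3) [symmetric] by (simp add: matrix_mul_simps matrix_mul_assoc)
    finally have "J = transpose D ** J ** D + transpose D ** R ** Z ** P ** J ** D"
      using eqs(4) by (simp add: P_def R_def matrix_mul_assoc)
    also have "\<dots> = transpose D ** K ** J ** D"
      by (simp add: K_def matrix_mul_simps matrix_mul_assoc)
    finally have "even_det J = even_det D * even_det K * even_det J * even_det D"
      using even_det_mul [of "transpose D ** K ** J" D] even_det_mul [of "transpose D ** K" J]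
        even_det_mul [of "transpose D" K]
      by (simp add: even_mat_simps parity_mul even_det_transpose)
    then have EJ: "(even_det D * even_det D * even_det K) * even_det J = even_det J"
      by (simp only: even_det_ac)
    define J' :: "'k grassmann ^ ('n \<times> bool) ^ ('n \<times> bool)" where "J' = 2 *\<^sub>R Omega"
    have "even_mat J'" by (auto simp: J'_def Omega_eq intro: even_real_mat)
    then have "even_det J' * even_det J = even_det (J' ** J)" by (simp add: even_det_mul)
    then have JJ': "even_det J * even_det J' = 1"
      unfolding J'_def JJ even_det_1 by (simp only: even_det_commute [of J])
    have "even_det D * even_det D * even_det K
        = ((even_det D * even_det D * even_det K) * even_det J) * even_det J'"
      by (simp only: mult.assoc JJ' mult_1_right)
    then have 1: "even_det D * even_det D * even_det K = 1" by (simp only: EJ JJ')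
    have 2: "even_det (mat 1 - R ** P) * even_det K = 1"
      using even_det_mul [of "mat 1 - R ** P" K] K by (simp add: even_mat_simps parity_mul)
    have "even_det D * even_det D = even_det D * even_det D * (even_det (mat 1 - R ** P) * even_det K)"
      by (simp only: 2 mult_1_right)
    also have "\<dots> = (even_det D * even_det D * even_det K) * even_det (mat 1 - R ** P)"
      by (simp only: even_det_ac)
    finally show ?thesis by (simp only: 1 mult_1_left)
  qed
  moreover have "\<delta> * \<delta> = (even_det A * even_det A) * (even_det D * even_det D)"
    by (simp only: \<delta>_def even_det_ac)
  ultimately have sq: "\<delta> * \<delta> = 1" by (simp add: even_det_odd_swap)
  define b where "b = det (body_mat A)"
  have b: "body \<delta> = b"
    using det_symplectic [OF O\<^sub>0_body(2) [OF M]]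
    by (simp add: \<delta>_def b_def body_even_det D_def [symmetric])
  have "b * b = 1"
    using arg_cong [OF O\<^sub>0_body(1) [OF M], of det] by (simp add: b_def A_def det_mul)
  \<comment> \<open>The difference \<open>x\<close> from the body is a multiple of \<open>x * x\<close> and therefore zero.\<close>
  define x where "x = \<delta> - of_real b"
  have two: "(2 * b) *\<^sub>R y = b *\<^sub>R y + b *\<^sub>R y" for y :: "'k grassmann"
    by (simp flip: scaleR_left_distrib)
  have "x * x = (1 + 1) - (b *\<^sub>R \<delta> + b *\<^sub>R \<delta>)"
    using \<open>b * b = 1\<close> by (simp add: x_def sq algebra_simps of_real_def)
  also have "\<dots> = - ((2 * b) *\<^sub>R x)"
    using \<open>b * b = 1\<close> by (simp add: two) (simp add: x_def of_real_def scaleR_diff_right)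
  finally have "(b / 2) *\<^sub>R (x * x) = - ((b * b) *\<^sub>R x)" by simp
  then have "x = (- (b / 2) *\<^sub>R x) * x" by (simp add: \<open>b * b = 1\<close>)
  then have "x = 0" by (rule body_zero_fixed [rotated]) (simp add: x_def b)
  then have "\<delta> = of_real b" by (simp add: x_def)
  then show ?thesis by (simp add: sdet_iff b_def A_def)
qed

section \<open>The group \<open>SO\<^sub>0\<close>\<close>

lemma SO\<^sub>0_iff: "M \<in> SO\<^sub>0 \<longleftrightarrow> M \<in> Mat \<and> star M ** M = mat 1 \<and> det (body_mat (blockA M)) = 1"
  using sdet_eq_1_iff by (auto simp: SO\<^sub>0_def O\<^sub>0_iff)

lemma SO\<^sub>0_mul:
  assumes "M \<in> SO\<^sub>0" "N \<in> SO\<^sub>0"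
  shows "M ** N \<in> SO\<^sub>0"
proof -
  have M: "M \<in> Mat" "star M ** M = mat 1" "det (body_mat (blockA M)) = 1"
    and N: "N \<in> Mat" "star N ** N = mat 1" "det (body_mat (blockA N)) = 1"
    using assms by (auto simp: SO\<^sub>0_iff)
  have "star (M ** N) ** (M ** N) = star N ** (star M ** M) ** N"
    by (simp only: star_mul M(1) N(1) matrix_mul_assoc)
  then show ?thesis
    using M N by (simp add: SO\<^sub>0_iff Mat_mul body_mat_blockA_mul det_mul)
qed

lemma star_SO\<^sub>0:
  assumes "M \<in> SO\<^sub>0"
  shows "star M \<in> SO\<^sub>0"
proof -
  have M: "M \<in> Mat" "star M ** M = mat 1" "det (body_mat (blockA M)) = 1"
    using assms by (auto simp: SO\<^sub>0_iff)
  have inv: "M ** star M = mat 1" by (rule matrix_algebra.unitI_left(2) [OF M(2)])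
  have "star (star M) ** star M = mat 1"
    using star_mul [OF M(1) star_Mat [OF M(1)]] by (simp add: inv star_one)
  moreover have "det (body_mat (blockA M)) * det (body_mat (blockA (star M))) = 1"
    by (simp add: inv block_one flip: det_mul body_mat_blockA_mul [OF M(1)])
  ultimately show ?thesis using M by (simp add: SO\<^sub>0_iff star_Mat)
qed

lemma one_SO\<^sub>0: "mat 1 \<in> SO\<^sub>0"
  by (simp add: SO\<^sub>0_iff one_in_Mat star_one block_one)

lemma blockA_uminus: "blockA (- M) = - blockA M" and blockA_diff: "blockA (M - N) = blockA M - blockA N"
  by (simp_all add: block_defs vec_eq_iff)

lemma skew_blockA:
  assumes "star X = - X"
  shows "transpose (blockA X) = - blockA X"
proof -
  have "Q_form ** star X = (Q_form ** Q_inverse) ** supertranspose X ** Q_form"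
    by (simp only: star_def matrix_mul_assoc)
  then have "supertranspose X ** Q_form = - (Q_form ** X)"
    by (simp add: Q_inverse assms matrix_mul_simps)
  from arg_cong [OF this, of blockA] show ?thesis
    by (simp add: block_mul supertranspose_def Q_form_def matrix_mul_simps blockA_uminus)
qed

text \<open>The body of the upper left block of a Cayley transform is the Cayley transform of a real
  antisymmetric matrix \<open>S\<close>, whose determinant is \<open>1\<close> because \<open>1 - S\<close> is the transpose of \<open>1 + S\<close>.\<close>

lemma cayley_SO\<^sub>0:
  assumes X: "X \<in> Mat" "star X = - X" and unit: "matrix_algebra.unit (mat 1 + X)"
    and orth: "star (matrix_algebra.cayley X) ** matrix_algebra.cayley X = mat 1"
  shows "matrix_algebra.cayley X \<in> SO\<^sub>0"
proof -
  let ?c = "matrix_algebra.cayley X" and ?a = "\<lambda>M. body_mat (blockA M)"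
  have c: "?c \<in> Mat"
    by (rule matrix_algebra.cayley_in_subalgebra [OF subspace_Mat one_in_Mat Mat_mul X(1) unit])
  have in_Mat: "mat 1 + X \<in> Mat" by (intro subspace_add subspace_Mat one_in_Mat X)
  define S where "S = ?a X"
  have S: "transpose S = - S"
    using arg_cong [OF skew_blockA [OF X(2)], of body_mat] by (simp add: S_def)
  have "?a (mat 1 + X) ** ?a (matrix_algebra.inverse_of (mat 1 + X)) = mat 1"
    by (simp add: matrix_algebra.inverse_of unit block_one flip: body_mat_blockA_mul [OF in_Mat])
  from arg_cong [OF this, of det] have nz: "det (mat 1 + S) \<noteq> 0"
    by (auto simp: det_mul block_add block_one S_def)
  have "?c ** (mat 1 + X) = mat 1 + (- X)"
    by (simp add: matrix_algebra.cayley_def matrix_algebra.inverse_of unit flip: matrix_mul_assoc)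
  then have "?a ?c ** (mat 1 + S) = ?a (mat 1 + (- X))"
    using body_mat_blockA_mul [OF c, of "mat 1 + X"] by (simp add: block_add blockA_diff block_one S_def)
  also have "\<dots> = transpose (mat 1 + S)"
    by (simp add: blockA_diff block_one transpose_linear S) (simp add: S_def)
  finally have "det (?a ?c) * det (mat 1 + S) = 1 * det (mat 1 + S)"
    by (metis det_mul det_transpose mult_1)
  then show ?thesis using nz c orth by (simp add: SO\<^sub>0_iff)
qed

lemma cayley_group_SO\<^sub>0:
  "cayley_group (**) (mat 1) Mat star (SO\<^sub>0 :: ('m::finite, 'n::finite, 'k::{finite,linorder}) supermatrix set)"
  by (intro cayley_group.intro cayley_group_axioms.intro matrix_algebra.fin_dim_algebra_axioms)
    (auto intro: subspace_Mat one_in_Mat Mat_mul linear_star star_mul star_one one_SO\<^sub>0 SO\<^sub>0_mul star_SO\<^sub>0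
      cayley_SO\<^sub>0 dest: SO\<^sub>0_iff [THEN iffD1])

interpretation SO\<^sub>0: cayley_group "(**)" "mat 1" Mat star
  "SO\<^sub>0 :: ('m::finite, 'n::finite, 'k::{finite,linorder}) supermatrix set"
  by (rule cayley_group_SO\<^sub>0)


section \<open>Connectedness\<close>

text \<open>If the body of \<open>M\<close> is the identity, its Cayley transform has body zero, and the line from zero to it
  consists of elements whose Cayley transform exists.\<close>

lemma path_component_unipotent:
  fixes M :: "('m::finite, 'n::finite, 'k::{finite,linorder}) supermatrix"
  assumes M: "M \<in> SO\<^sub>0" and body: "body_mat M = mat 1"
  shows "path_component SO\<^sub>0 (mat 1) M"
proof -
  have "body_mat ((1/2) *\<^sub>R (mat 1 + M)) = mat 1" by (simp add: body flip: scaleR_2)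
  then have "matrix_algebra.unit ((1/2) *\<^sub>R (mat 1 + M))" by (rule unit_of_body)
  from matrix_algebra.unit_scaleR [OF this, of 2] have unit: "matrix_algebra.unit (mat 1 + M)" by simp
  define X where "X = matrix_algebra.cayley M"
  have X: "X \<in> SO\<^sub>0.skew" unfolding X_def by (rule SO\<^sub>0.cayley_G [OF M unit])
  have "body_mat X = 0" by (simp add: X_def matrix_algebra.cayley_def body matrix_mul_simps)
  then have units: "matrix_algebra.unit (mat 1 + t *\<^sub>R X)" for t
    by (intro unit_of_body) simp
  have "continuous_on {0..1} (\<lambda>t::real. matrix_algebra.cayley (t *\<^sub>R X))"
    by (intro matrix_algebra.continuous_on_cayley continuous_intros units)
  then have "path_component SO\<^sub>0 (matrix_algebra.cayley (0 *\<^sub>R X)) (matrix_algebra.cayley (1 *\<^sub>R X))"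
    by (rule path_componentI_continuous)
      (intro SO\<^sub>0.cayley_skew units subspace_scale SO\<^sub>0.subspace_skew X)
  then show ?thesis by (simp add: X_def matrix_algebra.cayley_cayley unit)
qed

definition real_super :: "real ^ 'm ^ 'm \<Rightarrow> real ^ ('n \<times> bool) ^ ('n \<times> bool) \<Rightarrow>
    ('m::finite, 'n::finite, 'k::{finite,linorder}) supermatrix" where
  "real_super A D = block_matrix (real_mat A) 0 0 (real_mat D)"

lemma real_super_mul: "real_super A D ** real_super A' D' = real_super (A ** A') (D ** D')"
  by (rule block_eqI) (simp_all add: real_super_def block_mul real_mat_mul matrix_mul_simps)

lemma real_super_one: "real_super (mat 1) (mat 1) = mat 1"
  by (rule block_eqI) (simp_all add: real_super_def block_one real_mat_simps)

lemma real_super_Mat: "real_super A D \<in> Mat"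
  by (auto simp: Mat_iff real_super_def intro: even_real_mat)

lemma real_super_SO\<^sub>0:
  assumes "A \<in> special_orthogonal" "D \<in> symplectic"
  shows "(real_super A D :: ('m::finite, 'n::finite, 'k::{finite,linorder}) supermatrix) \<in> SO\<^sub>0"
proof -
  let ?M = "real_super A D :: ('m, 'n, 'k) supermatrix"
  have Q: "Q_form = real_super (mat 1) ((- 1/2) *\<^sub>R Omega_real)"
    by (simp add: Q_form_def real_super_def Omega_eq real_mat_simps)
  have "supertranspose ?M = real_super (transpose A) (transpose D)"
    by (simp add: supertranspose_def real_super_def real_mat_simps transpose_linear)
  then have "supertranspose ?M ** Q_form ** ?M = Q_form"
    using assms unfolding Q by (simp only: real_super_mul special_orthogonal_def symplectic_def matrix_mul_simps mem_Collect_eq matrix_mul_rid)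
  then have "?M \<in> O\<^sub>0" by (simp add: O\<^sub>0_def real_super_Mat)
  then show ?thesis
    using assms(1) by (simp add: SO\<^sub>0_iff O\<^sub>0_iff) (simp add: real_super_def special_orthogonal_def)
qed

lemma continuous_on_real_super:
  assumes "continuous_on S f" "continuous_on S g"
  shows "continuous_on S (\<lambda>x. real_super (f x) (g x))"
proof -
  have "linear (\<lambda>(A, D). real_super A D)"
    by (rule linearI)
      (auto intro!: block_eqI simp: real_super_def block_add block_scaleR real_mat_simps)
  then have "continuous_on UNIV (\<lambda>(A, D). real_super A D)"
    by (intro linear_continuous_on) (simp add: linear_conv_bounded_linear)
  from continuous_on_compose2 [OF this continuous_on_Pair [OF assms]] show ?thesis by simp
qed

lemma path_component_real_super:
  fixes A :: "real ^ 'm ^ 'm" and D :: "real ^ ('n::finite \<times> bool) ^ ('n \<times> bool)"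
  assumes A: "A \<in> special_orthogonal" and D: "D \<in> symplectic"
  shows "path_component (SO\<^sub>0 :: ('m, 'n, 'k::{finite,linorder}) supermatrix set) (mat 1) (real_super A D)"
proof -
  obtain g where g: "path g" "path_image g \<subseteq> special_orthogonal" "pathstart g = mat 1" "pathfinish g = A"
    using path_component_special_orthogonal [OF A] by (auto simp: path_component_def)
  obtain h where h: "path h" "path_image h \<subseteq> symplectic" "pathstart h = mat 1" "pathfinish h = D"
    using path_component_symplectic [OF D] by (auto simp: path_component_def)
  have "continuous_on {0..1} (\<lambda>t. real_super (g t) (h t))"
    using g(1) h(1) by (intro continuous_on_real_super) (auto simp: path_def)
  then have "path_component (SO\<^sub>0 :: ('m, 'n, 'k) supermatrix set)
      (real_super (g 0) (h 0)) (real_super (g 1) (h 1))"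
    by (rule path_componentI_continuous)
      (use g(2) h(2) in \<open>auto intro!: real_super_SO\<^sub>0 simp: path_image_def\<close>)
  then show ?thesis
    using g(3,4) h(3,4) by (simp add: pathstart_def pathfinish_def real_super_one)
qed

lemma path_component_SO\<^sub>0:
  fixes M :: "('m::finite, 'n::finite, 'k::{finite,linorder}) supermatrix"
  assumes M: "M \<in> SO\<^sub>0"
  shows "path_component SO\<^sub>0 (mat 1) M"
proof -
  define A D where "A = body_mat (blockA M)" and "D = body_mat (blockD M)"
  have "M \<in> O\<^sub>0" "det A = 1" using M by (auto simp: SO\<^sub>0_iff O\<^sub>0_iff A_def)
  then have A: "A \<in> special_orthogonal" and D: "D \<in> symplectic"
    using O\<^sub>0_body by (auto simp: special_orthogonal_def A_def D_def)
  define M0 :: "('m, 'n, 'k) supermatrix" where "M0 = real_super A D"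
  have M0: "M0 \<in> SO\<^sub>0" unfolding M0_def by (rule real_super_SO\<^sub>0 [OF A D])
  have "body_mat M = body_mat M0"
    using M by (intro body_mat_eqI) (simp_all add: SO\<^sub>0_iff M0_def real_super_Mat, simp_all add: real_super_def A_def D_def)
  then have "body_mat (M ** star M0) = body_mat (M0 ** star M0)" by simp
  then have "body_mat (M ** star M0) = mat 1" by (simp add: SO\<^sub>0.star_G' M0)
  then have "path_component SO\<^sub>0 (mat 1) (M ** star M0)"
    by (intro path_component_unipotent SO\<^sub>0_mul star_SO\<^sub>0 M M0)
  moreover have "path_component SO\<^sub>0 (mat 1) M0"
    unfolding M0_def by (rule path_component_real_super [OF A D])
  ultimately have "path_component SO\<^sub>0 (mat 1) (M ** star M0 ** M0)"
    by (rule path_component_product [rotated]) (rule SO\<^sub>0_mul)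
  then show ?thesis by (simp add: SO\<^sub>0.star_G M0 flip: matrix_mul_assoc)
qed

theorem proposition5:
  shows "(\<exists>(V :: ('m::finite, 'n::finite, 'k::{finite,linorder}) supermatrix set)
           (\<A> :: (('m, 'n, 'k) supermatrix, ('m, 'n, 'k) supermatrix) chart set).
             lie_group V \<A> (top_of_set SO\<^sub>0) SO\<^sub>0_group) \<and>
         connected (SO\<^sub>0 :: ('m, 'n, 'k) supermatrix set)"
proof
  have "SO\<^sub>0.the_group = (SO\<^sub>0_group :: ('m, 'n, 'k) supermatrix monoid)"
    by (simp add: SO\<^sub>0.the_group_def SO\<^sub>0_group_def)
  then show "\<exists>(V :: ('m, 'n, 'k) supermatrix set)
      (\<A> :: (('m, 'n, 'k) supermatrix, ('m, 'n, 'k) supermatrix) chart set).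
        lie_group V \<A> (top_of_set SO\<^sub>0) SO\<^sub>0_group"
    using SO\<^sub>0.lie_group_G by metis
  have "path_component SO\<^sub>0 M N" if "M \<in> SO\<^sub>0" "N \<in> SO\<^sub>0" for M N :: "('m, 'n, 'k) supermatrix"
    using path_component_SO\<^sub>0 [OF that(1)] path_component_SO\<^sub>0 [OF that(2)]
    by (blast intro: path_component_sym path_component_trans)
  then show "connected (SO\<^sub>0 :: ('m, 'n, 'k) supermatrix set)"
    by (intro path_connected_imp_connected) (simp add: path_connected_component)
qed

end
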